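(* Let $P$ be a bounded ordered set with at least two elements and let $G$ be a group. Then there exists a bounded lattice $L$ such that the ordered set $\operatorname{Princ} L$ of principal congruences of $L$ is order isomorphic to $P$, and the automorphism group $\operatorname{Aut} L$ of $L$ is group isomorphic to $G$.
   Context: A bounded ordered set is a partially ordered set with a least and a greatest element. For a lattice $L$, a principal congruence is a congruence of the form $\operatorname{con}(a,b)$, the smallest congruence of $L$ identifying $a$ and $b$, for some $a,b\in L$; $\operatorname{Princ} L$ denotes the set of principal congruences of $L$ ordered by inclusion. $\operatorname{Aut} L$ denotes the group of lattice automorphisms of $L$ under composition. *)

theory Defs
  imports "HOL-Algebra.Lattice" "HOL-Algebra.Group"
begin

definition bounded_poset :: "('a, 'b) gorder_scheme \<Rightarrow> bool" where
  "bounded_poset P \<longleftrightarrow> partial_order P \<and>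
     (\<exists>x. least P x (carrier P)) \<and> (\<exists>x. greatest P x (carrier P))"

definition lattice_congruence :: "('a, 'b) gorder_scheme \<Rightarrow> ('a \<times> 'a) set \<Rightarrow> bool" where
  "lattice_congruence L \<theta> \<longleftrightarrow> equiv (carrier L) \<theta> \<and>
     (\<forall>a b c d. (a, b) \<in> \<theta> \<longrightarrow> (c, d) \<in> \<theta> \<longrightarrow>
        (a \<squnion>\<^bsub>L\<^esub> c, b \<squnion>\<^bsub>L\<^esub> d) \<in> \<theta> \<and> (a \<sqinter>\<^bsub>L\<^esub> c, b \<sqinter>\<^bsub>L\<^esub> d) \<in> \<theta>)"

definition con :: "('a, 'b) gorder_scheme \<Rightarrow> 'a \<Rightarrow> 'a \<Rightarrow> ('a \<times> 'a) set" where
  "con L a b = \<Inter>{\<theta>. lattice_congruence L \<theta> \<and> (a, b) \<in> \<theta>}"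

definition Princ :: "('a, 'b) gorder_scheme \<Rightarrow> ('a \<times> 'a) set set" where
  "Princ L = {con L a b | a b. a \<in> carrier L \<and> b \<in> carrier L}"

definition order_iso_to_sets :: "('p, 'b) gorder_scheme \<Rightarrow> 'c set set \<Rightarrow> bool" where
  "order_iso_to_sets P S \<longleftrightarrow> (\<exists>\<phi>. bij_betw \<phi> (carrier P) S \<and>
     (\<forall>x\<in>carrier P. \<forall>y\<in>carrier P. x \<sqsubseteq>\<^bsub>P\<^esub> y \<longleftrightarrow> \<phi> x \<subseteq> \<phi> y))"

definition lattice_auts :: "('a, 'b) gorder_scheme \<Rightarrow> ('a \<Rightarrow> 'a) set" where
  "lattice_auts L = {f. f \<in> extensional (carrier L) \<and> bij_betw f (carrier L) (carrier L) \<and>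
     (\<forall>x\<in>carrier L. \<forall>y\<in>carrier L.
        f (x \<squnion>\<^bsub>L\<^esub> y) = f x \<squnion>\<^bsub>L\<^esub> f y \<and> f (x \<sqinter>\<^bsub>L\<^esub> y) = f x \<sqinter>\<^bsub>L\<^esub> f y)}"

definition Aut :: "('a, 'b) gorder_scheme \<Rightarrow> ('a \<Rightarrow> 'a) monoid" where
  "Aut L = \<lparr>carrier = lattice_auts L, mult = (\<lambda>f g. compose (carrier L) f g),
            one = (\<lambda>x\<in>carrier L. x)\<rparr>"

end

theory Submission
  imports Defs
begin

text \<open>Let \<open>P'\<close> be \<open>P\<close> without its bounds. The lattice consists of sets of points, ordered by inclusion,
  that lie in common blocks, together with a top element. Each \<open>p \<in> P'\<close> contributes a
  prime interval \<open>{p} < {p, b p}\<close>, and for \<open>p < q\<close> the closed sets \<open>{p, q} < {p, b p, q} < {p, b p, q, b q}\<close>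
  show that collapsing the interval of \<open>q\<close> collapses that of \<open>p\<close>. Pairs of incomparable elements
  generate the top element, so that no joins of these congruences appear as principal
  congruences. Every other principal congruence is trivial or total, because it identifies the
  bottom element with an atom. The blocks not needed for \<open>P\<close> are used for rigidity: initial
  segments of a well-order fix the points of \<open>P'\<close> and the colours \<open>s \<in> G\<close>, and the blocks
  \<open>{g, (g s)', s}\<close> form the coloured Cayley diagram of \<open>G\<close>, whose automorphisms are the left
  translations.\<close>

section \<open>Lattices of closed sets\<close>

text \<open>A lattice automorphism is only known to permute the points and to respect closures of
  pairs of points, so whatever has to be rigid must be readable from such closures. Therefore
  distinct blocks that are not both inside the rigid set \<open>R\<close> share at most one point,
  and a pair in a block outside \<open>R\<close> generates that block. This is why the Cayley
  diagram uses two copies of the group: with a single copy, a point g and a colour s with s^2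
  different from 1 would lie both in the edge leaving g and in the edge entering g, and the closure
  of the pair would lose both. Every group element is a colour, so no generating set has to be
  chosen, and colour \<open>\<one>\<close> ties the two copies together. On the side of congruences
  the obstacle is that two closed sets may differ in several markers. The congruence generated by
  such a pair is again that of one point only if the differing markers have a largest one. So a
  proper closed set may contain only few points of \<open>P'\<close>: at most two, and these
  comparable. The top element escapes this restriction because it is the only closed set containing
  all points.\<close>

text \<open>The injection \<open>e\<close> only moves the closed sets to the type required of the lattice elements.\<close>

locale closure_lattice =
  fixes K :: "'a set set" and E :: "'a set" and e :: "'a \<Rightarrow> 'b"
  assumes K_sub: "X \<in> K \<Longrightarrow> X \<subseteq> E"
    and E_in: "E \<in> K"
    and K_Inter: "A \<subseteq> K \<Longrightarrow> A \<noteq> {} \<Longrightarrow> \<Inter>A \<in> K"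
    and inj_e: "inj e"
begin

section \<open>The lattice of closed sets\<close>

definition jn :: "'a set \<Rightarrow> 'a set \<Rightarrow> 'a set" where
  "jn X Y = \<Inter>{Z \<in> K. X \<union> Y \<subseteq> Z}"

definition lat :: "'b set gorder" where
  "lat = \<lparr>carrier = image e ` K, eq = (=), le = (\<subseteq>)\<rparr>"

definition cg :: "('a set \<times> 'a set) set \<Rightarrow> bool" where
  "cg R \<longleftrightarrow> equiv K R \<and>
     (\<forall>a b c d. (a, b) \<in> R \<longrightarrow> (c, d) \<in> R \<longrightarrow> (jn a c, jn b d) \<in> R \<and> (a \<inter> c, b \<inter> d) \<in> R)"

definition lift :: "('a set \<times> 'a set) set \<Rightarrow> ('b set \<times> 'b set) set" where
  "lift R = map_prod (image e) (image e) ` R"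

definition order_aut :: "('a set \<Rightarrow> 'a set) \<Rightarrow> bool" where
  "order_aut h \<longleftrightarrow> bij_betw h K K \<and> (\<forall>X\<in>K. \<forall>Y\<in>K. X \<subseteq> Y \<longleftrightarrow> h X \<subseteq> h Y)"

lemma image_e_eq [simp]: "e ` X = e ` Y \<longleftrightarrow> X = Y"
  using inj_e by (simp add: inj_image_eq_iff)

lemma image_e_sub [simp]: "e ` X \<subseteq> e ` Y \<longleftrightarrow> X \<subseteq> Y"
  using inj_e by (simp add: inj_image_subset_iff)

lemma vimage_image_e [simp]: "e -` e ` X = X"
  using inj_e by (simp add: inj_vimage_image_eq)

lemma lat_simps [simp]: "carrier lat = image e ` K" "eq lat = (=)" "le lat = (\<subseteq>)"
  by (simp_all add: lat_def)

lemma jn_in [simp]: "X \<in> K \<Longrightarrow> Y \<in> K \<Longrightarrow> jn X Y \<in> K"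
  unfolding jn_def using K_sub E_in by (intro K_Inter) auto

lemma Int_in [simp]: "X \<in> K \<Longrightarrow> Y \<in> K \<Longrightarrow> X \<inter> Y \<in> K"
  using K_Inter[of "{X, Y}"] by simp

lemma jn_upper: "X \<subseteq> jn X Y" "Y \<subseteq> jn X Y"
  by (auto simp: jn_def)

lemma jn_least: "Z \<in> K \<Longrightarrow> X \<subseteq> Z \<Longrightarrow> Y \<subseteq> Z \<Longrightarrow> jn X Y \<subseteq> Z"
  by (auto simp: jn_def)

lemma jn_commute: "jn X Y = jn Y X"
  by (simp add: jn_def Un_commute)

lemma jn_absorb: "Y \<in> K \<Longrightarrow> X \<subseteq> Y \<Longrightarrow> jn X Y = Y"
  by (simp add: antisym jn_least jn_upper)

lemma partial_order_lat: "partial_order lat"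
  by unfold_locales auto

lemma least_lat:
  assumes "X \<in> K" "Y \<in> K"
  shows "least lat (e ` jn X Y) (Upper lat {e ` X, e ` Y})"
proof -
  have "Upper lat {e ` X, e ` Y} = image e ` {Z \<in> K. X \<subseteq> Z \<and> Y \<subseteq> Z}"
    using assms by (auto simp: Upper_def)
  then show ?thesis
    using assms by (auto simp: least_def jn_upper jn_least)
qed

lemma greatest_lat:
  assumes "X \<in> K" "Y \<in> K"
  shows "greatest lat (e ` (X \<inter> Y)) (Lower lat {e ` X, e ` Y})"
proof -
  have "Lower lat {e ` X, e ` Y} = image e ` {Z \<in> K. Z \<subseteq> X \<and> Z \<subseteq> Y}"
    using assms by (auto simp: Lower_def)
  then show ?thesis
    using assms by (auto simp: greatest_def)
qed

lemma join_lat: "X \<in> K \<Longrightarrow> Y \<in> K \<Longrightarrow> e ` X \<squnion>\<^bsub>lat\<^esub> e ` Y = e ` jn X Y"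
  unfolding join_def sup_def
  by (rule some_equality) (simp add: least_lat, metis least_lat partial_order.least_unique partial_order_lat)

lemma meet_lat: "X \<in> K \<Longrightarrow> Y \<in> K \<Longrightarrow> e ` X \<sqinter>\<^bsub>lat\<^esub> e ` Y = e ` (X \<inter> Y)"
  unfolding meet_def inf_def
  by (rule some_equality) (simp add: greatest_lat, metis greatest_lat partial_order.greatest_unique partial_order_lat)

lemma bounded_lattice_lat: "bounded_lattice lat"
proof -
  interpret partial_order lat by (rule partial_order_lat)
  have "\<Inter>K \<in> K" using K_Inter[of K] E_in by blast
  then have "least lat (e ` \<Inter>K) (carrier lat)" by (auto simp: least_def)
  moreover have "greatest lat (e ` E) (carrier lat)" using E_in K_sub by (auto simp: greatest_def)
  ultimately show ?thesis
    by unfold_locales (auto intro: least_lat greatest_lat)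
qed

section \<open>Congruences and principal congruences in terms of closed sets\<close>

lemma cgD:
  assumes "cg R"
  shows "(X, Y) \<in> R \<Longrightarrow> X \<in> K" "(X, Y) \<in> R \<Longrightarrow> Y \<in> K" "X \<in> K \<Longrightarrow> (X, X) \<in> R"
    "(X, Y) \<in> R \<Longrightarrow> (Y, X) \<in> R" "(X, Y) \<in> R \<Longrightarrow> (Y, Z) \<in> R \<Longrightarrow> (X, Z) \<in> R"
    "(X, Y) \<in> R \<Longrightarrow> Z \<in> K \<Longrightarrow> (jn X Z, jn Y Z) \<in> R"
    "(X, Y) \<in> R \<Longrightarrow> Z \<in> K \<Longrightarrow> (X \<inter> Z, Y \<inter> Z) \<in> R"
proof -
  have sub: "R \<subseteq> K \<times> K" and refl: "refl_on K R" and sym: "sym R" and trans: "trans R"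
    using assms by (simp_all add: cg_def equiv_def)
  have comp: "(jn a c, jn b d) \<in> R \<and> (a \<inter> c, b \<inter> d) \<in> R"
    if "(a, b) \<in> R" "(c, d) \<in> R" for a b c d
    using assms that by (simp add: cg_def)
  show r: "X \<in> K \<Longrightarrow> (X, X) \<in> R" for X using refl by (rule refl_onD)
  show "(X, Y) \<in> R \<Longrightarrow> X \<in> K" "(X, Y) \<in> R \<Longrightarrow> Y \<in> K" using sub by auto
  show "(X, Y) \<in> R \<Longrightarrow> (Y, X) \<in> R" using sym by (rule symD)
  show "(X, Y) \<in> R \<Longrightarrow> (Y, Z) \<in> R \<Longrightarrow> (X, Z) \<in> R" using trans by (rule transD)
  show "(X, Y) \<in> R \<Longrightarrow> Z \<in> K \<Longrightarrow> (jn X Z, jn Y Z) \<in> R"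
    "(X, Y) \<in> R \<Longrightarrow> Z \<in> K \<Longrightarrow> (X \<inter> Z, Y \<inter> Z) \<in> R"
    using comp r by blast+
qed

lemma cgI:
  assumes "R \<subseteq> K \<times> K" "\<And>X. X \<in> K \<Longrightarrow> (X, X) \<in> R" "\<And>X Y. (X, Y) \<in> R \<Longrightarrow> (Y, X) \<in> R"
    "\<And>X Y Z. (X, Y) \<in> R \<Longrightarrow> (Y, Z) \<in> R \<Longrightarrow> (X, Z) \<in> R"
    "\<And>X Y Z. (X, Y) \<in> R \<Longrightarrow> Z \<in> K \<Longrightarrow> (jn X Z, jn Y Z) \<in> R"
    "\<And>X Y Z. (X, Y) \<in> R \<Longrightarrow> Z \<in> K \<Longrightarrow> (X \<inter> Z, Y \<inter> Z) \<in> R"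
  shows "cg R"
  unfolding cg_def
proof (intro conjI allI impI)
  show "equiv K R"
    using assms by (intro equivI refl_onI symI transI) blast+
  fix a b c d assume ab: "(a, b) \<in> R" and cd: "(c, d) \<in> R"
  then have k: "b \<in> K" "c \<in> K" using assms(1) by auto
  show "(jn a c, jn b d) \<in> R"
    using assms(4)[OF assms(5)[OF ab k(2)]] assms(5)[OF cd k(1)] by (metis jn_commute)
  show "(a \<inter> c, b \<inter> d) \<in> R"
    using assms(4)[OF assms(6)[OF ab k(2)]] assms(6)[OF cd k(1)] by (metis Int_commute)
qed

lemma mem_lift [simp]: "(e ` X, e ` Y) \<in> lift R \<longleftrightarrow> (X, Y) \<in> R"
  by (auto simp: lift_def)

lemma lift_mono [simp]: "lift R \<subseteq> lift S \<longleftrightarrow> R \<subseteq> S"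
proof
  assume "lift R \<subseteq> lift S"
  then show "R \<subseteq> S" by (auto simp flip: mem_lift)
qed (auto simp: lift_def)

lemma lift_inject [simp]: "lift R = lift S \<longleftrightarrow> R = S"
  using lift_mono by blast

lemma lattice_congruence_lift:
  assumes "cg R" shows "lattice_congruence lat (lift R)"
proof -
  note R = cgD[OF assms]
  have "equiv (carrier lat) (lift R)"
  proof (rule equivI)
    show "lift R \<subseteq> carrier lat \<times> carrier lat" by (auto simp: lift_def dest: R)
    show "refl_on (carrier lat) (lift R)" by (auto simp: refl_on_def R(3))
    show "sym (lift R)"
    proof (rule symI)
      fix x y assume "(x, y) \<in> lift R"
      then obtain X Y where "(X, Y) \<in> R" "x = e ` X" "y = e ` Y" by (auto simp: lift_def)
      then show "(y, x) \<in> lift R" by (simp add: R(4))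
    qed
    show "trans (lift R)"
    proof (rule transI)
      fix x y w assume "(x, y) \<in> lift R" "(y, w) \<in> lift R"
      then obtain X Y W where "(X, Y) \<in> R" "(Y, W) \<in> R" "x = e ` X" "w = e ` W"
        by (auto simp: lift_def)
      then show "(x, w) \<in> lift R" using R(5) by simp
    qed
  qed
  moreover have "(a \<squnion>\<^bsub>lat\<^esub> c, b \<squnion>\<^bsub>lat\<^esub> d) \<in> lift R \<and> (a \<sqinter>\<^bsub>lat\<^esub> c, b \<sqinter>\<^bsub>lat\<^esub> d) \<in> lift R"
    if "(a, b) \<in> lift R" "(c, d) \<in> lift R" for a b c d
  proof -
    from that obtain A B C D where "(A, B) \<in> R" "(C, D) \<in> R"
      "a = e ` A" "b = e ` B" "c = e ` C" "d = e ` D" by (auto simp: lift_def)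
    then show ?thesis
      using assms by (auto simp: join_lat meet_lat R(1,2) cg_def)
  qed
  ultimately show ?thesis unfolding lattice_congruence_def by blast
qed

lemma lattice_congruence_lat_cases:
  assumes "lattice_congruence lat \<psi>"
  obtains R where "cg R" "\<psi> = lift R"
proof
  let ?R = "{(X, Y). X \<in> K \<and> Y \<in> K \<and> (e ` X, e ` Y) \<in> \<psi>}"
  have eq: "equiv (carrier lat) \<psi>" and
    c: "\<And>a b c d. (a, b) \<in> \<psi> \<Longrightarrow> (c, d) \<in> \<psi> \<Longrightarrow>
        (a \<squnion>\<^bsub>lat\<^esub> c, b \<squnion>\<^bsub>lat\<^esub> d) \<in> \<psi> \<and> (a \<sqinter>\<^bsub>lat\<^esub> c, b \<sqinter>\<^bsub>lat\<^esub> d) \<in> \<psi>"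
    using assms unfolding lattice_congruence_def by blast+
  have sub: "\<psi> \<subseteq> carrier lat \<times> carrier lat" using eq by (auto simp: equiv_def)
  have refl: "\<And>X. X \<in> K \<Longrightarrow> (e ` X, e ` X) \<in> \<psi>"
    using eq by (auto simp: equiv_def refl_on_def)
  show "\<psi> = lift ?R"
  proof
    show "\<psi> \<subseteq> lift ?R"
    proof
      fix x assume x: "x \<in> \<psi>"
      then obtain X Y where "x = (e ` X, e ` Y)" "X \<in> K" "Y \<in> K" using sub by auto
      then show "x \<in> lift ?R" using x by simp
    qed
  qed (auto simp: lift_def)
  show "cg ?R"
  proof (rule cgI)
    fix X Y Z assume XY: "(X, Y) \<in> ?R" and Z: "Z \<in> K"
    show "(jn X Z, jn Y Z) \<in> ?R" "(X \<inter> Z, Y \<inter> Z) \<in> ?R"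
      using XY Z c[of "e ` X" "e ` Y" "e ` Z" "e ` Z"] refl[OF Z] by (auto simp: join_lat meet_lat)
  qed (use refl eq in \<open>auto simp: equiv_def dest: symD transD\<close>)
qed

text \<open>Every congruence of \<open>lat\<close> is the \<open>lift\<close> of some
  \<open>cg\<close>, so the intersection defining \<open>con\<close> can be evaluated on closed
  sets: a least \<open>cg\<close> containing the pair is enough.\<close>

lemma con_lat:
  assumes "cg R" "(X, Y) \<in> R" "\<And>S. cg S \<Longrightarrow> (X, Y) \<in> S \<Longrightarrow> R \<subseteq> S"
  shows "con lat (e ` X) (e ` Y) = lift R"
proof
  show "con lat (e ` X) (e ` Y) \<subseteq> lift R"
    unfolding con_def using assms lattice_congruence_lift by auto
  show "lift R \<subseteq> con lat (e ` X) (e ` Y)"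
    unfolding con_def
  proof (rule Inter_greatest)
    fix \<psi> assume "\<psi> \<in> {\<theta>. lattice_congruence lat \<theta> \<and> (e ` X, e ` Y) \<in> \<theta>}"
    then obtain S where "cg S" "\<psi> = lift S" "(X, Y) \<in> S"
      by (metis (no_types, lifting) lattice_congruence_lat_cases mem_Collect_eq mem_lift)
    then show "lift R \<subseteq> \<psi>" using assms by simp
  qed
qed

section \<open>Automorphisms in terms of closed sets\<close>

lemma order_autD:
  assumes "order_aut h"
  shows "bij_betw h K K" "X \<in> K \<Longrightarrow> Y \<in> K \<Longrightarrow> X \<subseteq> Y \<longleftrightarrow> h X \<subseteq> h Y"
proof -
  note conj = assms[unfolded order_aut_def]
  show "bij_betw h K K" by (rule conjunct1[OF conj])
  show "X \<subseteq> Y \<longleftrightarrow> h X \<subseteq> h Y" if "X \<in> K" "Y \<in> K"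
    by (rule bspec[OF bspec[OF conjunct2[OF conj]]], rule that, rule that)
qed

lemma order_aut_jn_Int:
  assumes h: "order_aut h" and X: "X \<in> K" and Y: "Y \<in> K"
  shows "h (jn X Y) = jn (h X) (h Y)" "h (X \<inter> Y) = h X \<inter> h Y"
proof -
  note bij = order_autD(1)[OF h] and le = order_autD(2)[OF h]
  have hK: "\<And>X. X \<in> K \<Longrightarrow> h X \<in> K" using bij by (auto simp: bij_betw_def)
  have pre: "\<exists>Z\<in>K. h Z = W" if "W \<in> K" for W
  proof -
    have "W \<in> h ` K" using bij that by (simp add: bij_betw_def)
    then show ?thesis by auto
  qed
  obtain Z where Z: "Z \<in> K" "h Z = jn (h X) (h Y)" using pre[of "jn (h X) (h Y)"] X Y hK by auto
  have "X \<subseteq> Z" "Y \<subseteq> Z" using le[of X Z] le[of Y Z] Z X Y by (simp_all add: jn_upper)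
  then have "h (jn X Y) \<subseteq> h Z" using le jn_least Z X Y by (meson jn_in)
  moreover have "jn (h X) (h Y) \<subseteq> h (jn X Y)"
    using X Y hK le[of X "jn X Y"] le[of Y "jn X Y"] by (intro jn_least) (simp_all add: jn_upper)
  ultimately show "h (jn X Y) = jn (h X) (h Y)" using Z by simp
  obtain Z where Z: "Z \<in> K" "h Z = h X \<inter> h Y" using pre[of "h X \<inter> h Y"] X Y hK by auto
  have "Z \<subseteq> X" "Z \<subseteq> Y" using le[of Z X] le[of Z Y] Z X Y by simp_all
  then have "h Z \<subseteq> h (X \<inter> Y)" using le[of Z "X \<inter> Y"] Z X Y by simp
  moreover have "h (X \<inter> Y) \<subseteq> h X \<inter> h Y"
    using X Y le[of "X \<inter> Y" X] le[of "X \<inter> Y" Y] by simp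
  ultimately show "h (X \<inter> Y) = h X \<inter> h Y" using Z by simp
qed

lemma lattice_autsI:
  assumes h: "order_aut h"
  shows "(\<lambda>x\<in>carrier lat. e ` h (e -` x)) \<in> lattice_auts lat"
proof -
  note b = order_autD(1)[OF h]
  then have hK: "\<And>X. X \<in> K \<Longrightarrow> h X \<in> K" by (auto simp: bij_betw_def)
  have "bij_betw (\<lambda>x\<in>carrier lat. e ` h (e -` x)) (carrier lat) (carrier lat)"
    unfolding bij_betw_def
  proof
    show "inj_on (\<lambda>x\<in>carrier lat. e ` h (e -` x)) (carrier lat)"
      using b by (auto simp: inj_on_def bij_betw_def)
    have "(\<lambda>x\<in>carrier lat. e ` h (e -` x)) ` carrier lat = image e ` h ` K"
      by (auto simp: image_image)
    then show "(\<lambda>x\<in>carrier lat. e ` h (e -` x)) ` carrier lat = carrier lat"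
      using b by (simp add: bij_betw_def)
  qed
  then show ?thesis
    unfolding lattice_auts_def using hK
    by (auto simp: join_lat meet_lat order_aut_jn_Int[OF h])
qed

text \<open>Preservation of meets already gives the order in both directions, since inclusion means
  \<open>X \<inter> Y = X\<close> and the induced map on \<open>K\<close> is injective.\<close>

lemma lattice_auts_order_aut:
  assumes f: "f \<in> lattice_auts lat"
  obtains h where "order_aut h" "\<And>X. X \<in> K \<Longrightarrow> f (e ` X) = e ` h X"
proof
  let ?h = "\<lambda>X. e -` f (e ` X)"
  have b: "bij_betw f (image e ` K) (image e ` K)"
    and m: "\<And>X Y. X \<in> K \<Longrightarrow> Y \<in> K \<Longrightarrow> f (e ` X \<sqinter>\<^bsub>lat\<^esub> e ` Y) = f (e ` X) \<sqinter>\<^bsub>lat\<^esub> f (e ` Y)"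
    using f by (auto simp: lattice_auts_def)
  have ex: "\<exists>Y\<in>K. f (e ` X) = e ` Y" if "X \<in> K" for X
  proof -
    have "f (e ` X) \<in> image e ` K" using b that by (blast dest: bij_betwE)
    then show ?thesis by auto
  qed
  show fh: "f (e ` X) = e ` ?h X" if "X \<in> K" for X
    using ex[OF that] by auto
  have hK: "?h X \<in> K" if "X \<in> K" for X
    using ex[OF that] by auto
  have inj: "inj_on ?h K"
  proof (rule inj_onI)
    fix X Y assume k: "X \<in> K" "Y \<in> K" and "?h X = ?h Y"
    then have "f (e ` X) = f (e ` Y)" using fh by metis
    then show "X = Y" using b k by (auto simp: bij_betw_def inj_on_def)
  qed
  have surj: "?h ` K = K"
  proof
    show "K \<subseteq> ?h ` K"
    proof
      fix Y assume "Y \<in> K"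
      then obtain X where "X \<in> K" "f (e ` X) = e ` Y"
        using b unfolding bij_betw_def by (metis (no_types, lifting) image_iff)
      then show "Y \<in> ?h ` K" by (intro rev_image_eqI[of X]) simp_all
    qed
  qed (use hK in auto)
  have int: "?h (X \<inter> Y) = ?h X \<inter> ?h Y" if "X \<in> K" "Y \<in> K" for X Y
  proof -
    obtain A B where "A \<in> K" "B \<in> K" "f (e ` X) = e ` A" "f (e ` Y) = e ` B"
      using ex[OF \<open>X \<in> K\<close>] ex[OF \<open>Y \<in> K\<close>] by blast
    moreover from this have "f (e ` (X \<inter> Y)) = e ` (A \<inter> B)"
      using m[OF that] that by (simp add: meet_lat)
    ultimately show ?thesis by simp
  qed
  have "X \<subseteq> Y \<longleftrightarrow> ?h X \<subseteq> ?h Y" if k: "X \<in> K" "Y \<in> K" for X Y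
  proof -
    have "X \<subseteq> Y \<longleftrightarrow> X \<inter> Y = X" by blast
    also have "\<dots> \<longleftrightarrow> ?h (X \<inter> Y) = ?h X"
      using inj_on_eq_iff[OF inj Int_in[OF k] k(1)] by simp
    also have "\<dots> \<longleftrightarrow> ?h X \<subseteq> ?h Y" using int[OF k] by auto
    finally show ?thesis .
  qed
  then show "order_aut ?h" using inj surj by (auto simp: order_aut_def bij_betw_def)
qed

end

section \<open>Lattices of coloured points\<close>

text \<open>Closed sets consist of points of \<open>I\<close> and of markers \<open>b q\<close> attached to the points \<open>q\<close> of \<open>Q\<close>; the
  points of a closed set are closed in the Moore family \<open>C\<close>. Collapsing \<open>{q}\<close> with \<open>{q, b q}\<close> is
  the principal congruence that represents \<open>q\<close>. The isolated point \<open>z\<close> is a complement of all other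
  atoms, which makes a congruence total as soon as it moves the bottom element.\<close>

locale coloured_points =
  fixes I Q :: "'a set" and b :: "'a \<Rightarrow> 'a" and ord :: "'a \<Rightarrow> 'a \<Rightarrow> bool"
    and C :: "'a set set" and z u v :: 'a and e :: "'a \<Rightarrow> 'b"
  assumes Q_sub: "Q \<subseteq> I" and inj_b: "inj_on b Q" and b_notin: "q \<in> Q \<Longrightarrow> b q \<notin> I"
    and ord_refl: "q \<in> Q \<Longrightarrow> ord q q"
    and ord_trans: "p \<in> Q \<Longrightarrow> q \<in> Q \<Longrightarrow> r \<in> Q \<Longrightarrow> ord p q \<Longrightarrow> ord q r \<Longrightarrow> ord p r"
    and ord_antisym: "p \<in> Q \<Longrightarrow> q \<in> Q \<Longrightarrow> ord p q \<Longrightarrow> ord q p \<Longrightarrow> p = q"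
    and C_sub: "S \<in> C \<Longrightarrow> S \<subseteq> I" and I_in: "I \<in> C"
    and C_Inter: "A \<subseteq> C \<Longrightarrow> A \<noteq> {} \<Longrightarrow> \<Inter>A \<in> C"
    and C_empty: "{} \<in> C" and C_single: "i \<in> I \<Longrightarrow> {i} \<in> C"
    and C_ord: "p \<in> Q \<Longrightarrow> q \<in> Q \<Longrightarrow> ord p q \<Longrightarrow> \<exists>S\<in>C. S \<noteq> I \<and> p \<in> S \<and> q \<in> S"
    and C_greatest: "S \<in> C \<Longrightarrow> S \<noteq> I \<Longrightarrow> D \<subseteq> S \<inter> Q \<Longrightarrow> D \<noteq> {} \<Longrightarrow> \<exists>d\<in>D. \<forall>d'\<in>D. ord d' d"
    and zuv: "z \<in> I" "u \<in> I" "v \<in> I" "u \<noteq> z" "v \<noteq> z" "u \<noteq> v"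
    and C_z: "S \<in> C \<Longrightarrow> z \<in> S \<Longrightarrow> S = {z} \<or> S = I"
    and C_uv: "S \<in> C \<Longrightarrow> u \<in> S \<Longrightarrow> v \<in> S \<Longrightarrow> S = I"
    and inj_e: "inj e"
begin

definition E :: "'a set" where "E = I \<union> b ` Q"

text \<open>If \<open>p \<le> q\<close> lie in a closed set that contains \<open>b q\<close>, then it contains \<open>b p\<close>. This is what makes the
  congruence of \<open>q\<close> contain that of \<open>p\<close>, but not conversely.\<close>

definition K :: "'a set set" where
  "K = {X. X \<subseteq> E \<and> X \<inter> I \<in> C \<and> (\<forall>q\<in>Q. b q \<in> X \<longrightarrow> q \<in> X) \<and>
     (\<forall>p\<in>Q. \<forall>q\<in>Q. ord p q \<longrightarrow> b q \<in> X \<longrightarrow> p \<in> X \<longrightarrow> b p \<in> X) \<and> (I \<subseteq> X \<longrightarrow> X = E)}"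

lemma I_E: "I \<subseteq> E" by (simp add: E_def)

lemma KD:
  assumes "X \<in> K"
  shows "X \<inter> I \<in> C" "q \<in> Q \<Longrightarrow> b q \<in> X \<Longrightarrow> q \<in> X"
    "p \<in> Q \<Longrightarrow> q \<in> Q \<Longrightarrow> ord p q \<Longrightarrow> b q \<in> X \<Longrightarrow> p \<in> X \<Longrightarrow> b p \<in> X"
    "X \<inter> I = I \<Longrightarrow> X = E" "x \<in> X \<Longrightarrow> x \<notin> I \<Longrightarrow> \<exists>q\<in>Q. x = b q" "X \<subseteq> E"
proof -
  have "X \<subseteq> E" and *: "X \<inter> I \<in> C" "\<forall>q\<in>Q. b q \<in> X \<longrightarrow> q \<in> X"
    "\<forall>p\<in>Q. \<forall>q\<in>Q. ord p q \<longrightarrow> b q \<in> X \<longrightarrow> p \<in> X \<longrightarrow> b p \<in> X" "I \<subseteq> X \<longrightarrow> X = E"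
    using assms by (simp_all add: K_def)
  then show "X \<inter> I \<in> C" "X \<subseteq> E" by simp_all
  show "q \<in> Q \<Longrightarrow> b q \<in> X \<Longrightarrow> q \<in> X" using *(2) by simp
  show "p \<in> Q \<Longrightarrow> q \<in> Q \<Longrightarrow> ord p q \<Longrightarrow> b q \<in> X \<Longrightarrow> p \<in> X \<Longrightarrow> b p \<in> X" using *(3) by simp
  show "X \<inter> I = I \<Longrightarrow> X = E" using *(4) by blast
  show "x \<in> X \<Longrightarrow> x \<notin> I \<Longrightarrow> \<exists>q\<in>Q. x = b q" using \<open>X \<subseteq> E\<close> unfolding E_def by auto
qed

lemma KI:
  assumes "X \<subseteq> E" "X \<inter> I \<in> C" "\<And>q. q \<in> Q \<Longrightarrow> b q \<in> X \<Longrightarrow> q \<in> X"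
    "\<And>p q. p \<in> Q \<Longrightarrow> q \<in> Q \<Longrightarrow> ord p q \<Longrightarrow> b q \<in> X \<Longrightarrow> p \<in> X \<Longrightarrow> b p \<in> X"
    "I \<subseteq> X \<Longrightarrow> X = E"
  shows "X \<in> K"
  unfolding K_def using assms by (intro CollectI conjI ballI impI) assumption+

lemma E_in_K: "E \<in> K"
  using Q_sub I_in I_E by (intro KI) (auto simp: E_def Int_absorb1)

lemma K_Inter:
  assumes "A \<subseteq> K" "A \<noteq> {}" shows "\<Inter>A \<in> K"
proof (rule KI)
  have AK: "X \<in> K" if "X \<in> A" for X using that assms(1) by blast
  obtain X0 where X0: "X0 \<in> A" using assms(2) by blast
  have "\<Inter>A \<inter> I = \<Inter>((\<lambda>X. X \<inter> I) ` A)" using X0 by blast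
  also have "\<dots> \<in> C" using assms AK KD(1) by (intro C_Inter) auto
  finally show "\<Inter>A \<inter> I \<in> C" .
  show "\<Inter>A \<subseteq> E" using X0 KD(6)[OF AK[OF X0]] by blast
  show "\<Inter>A = E" if "I \<subseteq> \<Inter>A"
  proof -
    have "X = E" if "X \<in> A" for X
      using that \<open>I \<subseteq> \<Inter>A\<close> by (intro KD(4)[OF AK]) auto
    then have "A = {E}" using X0 by blast
    then show ?thesis by simp
  qed
  show "q \<in> \<Inter>A" if "q \<in> Q" "b q \<in> \<Inter>A" for q
    using that by (auto intro: KD(2)[OF AK])
  show "b p \<in> \<Inter>A" if "p \<in> Q" "q \<in> Q" "ord p q" "b q \<in> \<Inter>A" "p \<in> \<Inter>A" for p q
    using that by (auto intro: KD(3)[OF AK])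
qed

sublocale closure_lattice K E e
  by unfold_locales (use E_in_K K_Inter inj_e KD(6) in auto)

lemma C_K:
  assumes "S \<in> C" "S \<noteq> I" shows "S \<in> K"
proof -
  have "S \<inter> I = S" using C_sub[OF assms(1)] by blast
  moreover have "b q \<notin> S" if "q \<in> Q" for q using that b_notin C_sub[OF assms(1)] by blast
  ultimately show ?thesis using assms C_sub[OF assms(1)] I_E by (intro KI) auto
qed

lemma proper_single: "{i} \<noteq> I"
  using zuv by auto

lemma single_K: "i \<in> I \<Longrightarrow> {i} \<in> K"
  using C_K C_single proper_single by blast

lemma empty_K: "{} \<in> K"
  using C_K C_empty zuv by blast

lemma b_eq: "p \<in> Q \<Longrightarrow> q \<in> Q \<Longrightarrow> b p = b q \<longleftrightarrow> p = q"
  using inj_b by (rule inj_on_eq_iff)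

lemma pair_K:
  assumes "p \<in> Q" shows "{p, b p} \<in> K"
proof (rule KI)
  have pI: "p \<in> I" using assms Q_sub by blast
  have bp: "b p \<notin> I" by (rule b_notin[OF assms])
  have "{p, b p} \<inter> I = {p}" using pI bp by blast
  then show "{p, b p} \<inter> I \<in> C" using C_single[OF pI] by simp
  show "{p, b p} = E" if "I \<subseteq> {p, b p}"
    using that bp proper_single[of p] pI by blast
  show "{p, b p} \<subseteq> E" using pI assms by (simp add: E_def)
  have bq: "b q \<noteq> p" if "q \<in> Q" for q using b_notin[OF that] pI by blast
  show "q \<in> {p, b p}" if "q \<in> Q" "b q \<in> {p, b p}" for q
    using that bq[OF that(1)] assms by (simp add: b_eq)
  show "b r \<in> {p, b p}" if "r \<in> Q" "r \<in> {p, b p}" for r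
    using that bp Q_sub by blast
qed

section \<open>Joins of closed sets\<close>

definition hull :: "'a set \<Rightarrow> 'a set" where
  "hull W = \<Inter>{S \<in> C. W \<subseteq> S}"

lemma hull_C: "W \<subseteq> I \<Longrightarrow> hull W \<in> C"
  unfolding hull_def using I_in by (intro C_Inter) auto

text \<open>One round of adding markers suffices: by transitivity of \<open>ord\<close>, a marker
  forced by an added marker is already forced by an original one. If the points generate all of
  \<open>I\<close>, the last clause of \<open>K\<close> leaves only the top
  \<open>E\<close>.\<close>

lemma jn_eq:
  assumes X: "X \<in> K" and Y: "Y \<in> K"
  defines "H \<equiv> hull ((X \<union> Y) \<inter> I)"
  shows "jn X Y = (if H = I then E
    else H \<union> {b p | p. p \<in> Q \<and> p \<in> H \<and> (\<exists>q\<in>Q. ord p q \<and> b q \<in> X \<union> Y)})"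
    (is "_ = ?J")
proof
  have HC: "H \<in> C" unfolding H_def by (rule hull_C) blast
  have HI: "H \<subseteq> I" by (rule C_sub[OF HC])
  have up: "(X \<union> Y) \<inter> I \<subseteq> H" unfolding H_def hull_def by blast
  have bH: "b q \<notin> H" if "q \<in> Q" for q using b_notin[OF that] HI by blast
  have "?J \<in> K"
  proof (cases "H = I")
    case True then show ?thesis by (simp add: E_in_K)
  next
    case False
    have tr: "?J \<inter> I = H" using False HI b_notin by auto
    have mem: "b q \<in> ?J \<longleftrightarrow> q \<in> H \<and> (\<exists>r\<in>Q. ord q r \<and> b r \<in> X \<union> Y)" if "q \<in> Q" for q
      using that False bH[OF that] by simp (blast dest: inj_onD[OF inj_b])
    have "?J \<subseteq> E" using False HI unfolding E_def by auto
    moreover have "\<not> I \<subseteq> ?J" using tr False by blast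
    moreover have "q \<in> ?J" if "q \<in> Q" "b q \<in> ?J" for q using mem that False by auto
    moreover have "b p \<in> ?J" if h: "p \<in> Q" "q \<in> Q" "ord p q" "b q \<in> ?J" "p \<in> ?J" for p q
    proof -
      obtain r where "r \<in> Q" "ord q r" "b r \<in> X \<union> Y" using mem[of q] h by blast
      moreover have "p \<in> H" using h(1,5) tr Q_sub by blast
      ultimately show ?thesis using mem[OF h(1)] ord_trans[of p q r] h by blast
    qed
    ultimately show ?thesis using tr HC by (intro KI) (assumption | simp)+
  qed
  moreover have "X \<union> Y \<subseteq> ?J"
  proof (cases "H = I")
    case True
    then show ?thesis using K_sub X Y by auto
  next
    case False
    have "x \<in> ?J" if x: "x \<in> X \<union> Y" "x \<notin> I" for x
    proof -
      obtain q where q: "q \<in> Q" "x = b q" using x KD(5)[OF X] KD(5)[OF Y] by blast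
      then have "q \<in> X \<union> Y" using x KD(2)[OF X] KD(2)[OF Y] by blast
      then have "q \<in> H" using up q Q_sub by blast
      then show ?thesis using False q x ord_refl by auto
    qed
    then show ?thesis using up False by auto
  qed
  ultimately show "jn X Y \<subseteq> ?J" by (intro jn_least) auto
  show "?J \<subseteq> jn X Y"
    unfolding jn_def
  proof (rule Inter_greatest)
    fix Z assume "Z \<in> {Z \<in> K. X \<union> Y \<subseteq> Z}"
    then have Z: "Z \<in> K" "X \<union> Y \<subseteq> Z" by auto
    have HZ: "H \<subseteq> Z \<inter> I"
      unfolding H_def hull_def using KD(1)[OF Z(1)] Z(2) by blast
    show "?J \<subseteq> Z"
    proof (cases "H = I")
      case True
      then show ?thesis using KD(4)[OF Z(1)] HZ by auto
    next
      case False
      have "b p \<in> Z" if "p \<in> Q" "p \<in> H" "q \<in> Q" "ord p q" "b q \<in> X \<union> Y" for p q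
        using KD(3)[OF Z(1)] that Z(2) HZ by blast
      then show ?thesis using False HZ by auto
    qed
  qed
qed

lemma jn_trace:
  assumes "X \<in> K" "Y \<in> K" shows "jn X Y \<inter> I = hull ((X \<union> Y) \<inter> I)"
proof -
  have "hull ((X \<union> Y) \<inter> I) \<subseteq> I" by (rule C_sub[OF hull_C]) blast
  then show ?thesis
    using b_notin I_E by (auto simp: jn_eq[OF assms])
qed

section \<open>The congruences of the lattice\<close>

text \<open>Away from equal pairs and the top, \<open>theta\<close> is the kernel of this map, so
  symmetry and transitivity come for free. The markers of points below \<open>d\<close> are exactly
  the ones it forgets.\<close>

definition colour :: "'a \<Rightarrow> 'a set \<Rightarrow> 'a set \<times> 'a set" where
  "colour d X = (X \<inter> I, {q \<in> Q. \<not> ord q d \<and> b q \<in> X})"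

definition theta :: "'a \<Rightarrow> ('a set \<times> 'a set) set" where
  "theta d = {(X, Y). X \<in> K \<and> Y \<in> K \<and> (X = Y \<or> X \<noteq> E \<and> Y \<noteq> E \<and> colour d X = colour d Y)}"

lemma theta_iff:
  "theta d = {(X, Y). X \<in> K \<and> Y \<in> K \<and> (X = Y \<or> X \<noteq> E \<and> Y \<noteq> E \<and> X \<inter> I = Y \<inter> I \<and>
     (\<forall>q\<in>Q. \<not> ord q d \<longrightarrow> (b q \<in> X \<longleftrightarrow> b q \<in> Y)))}"
proof -
  have "colour d X = colour d Y \<longleftrightarrow> X \<inter> I = Y \<inter> I \<and>
     (\<forall>q\<in>Q. \<not> ord q d \<longrightarrow> (b q \<in> X \<longleftrightarrow> b q \<in> Y))" for X Y
    unfolding colour_def by blast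
  then show ?thesis unfolding theta_def by presburger
qed

text \<open>The forgotten markers belong to a down-set. A marker \<open>b p\<close> of a join can
  only be forced by some \<open>b q\<close> with \<open>p\<close> below \<open>q\<close>; if
  \<open>p\<close> is not below \<open>d\<close>, neither is \<open>q\<close>, and such markers
  agree in the two sets.\<close>

lemma theta_cg:
  assumes d: "d \<in> Q" shows "cg (theta d)"
proof (rule cgI)
  fix X Y Z assume XY: "(X, Y) \<in> theta d" and Z: "Z \<in> K"
  have k: "X \<in> K" "Y \<in> K" using XY by (auto simp: theta_iff)
  have "X = Y \<or> X \<inter> Z \<noteq> E \<and> Y \<inter> Z \<noteq> E"
    using XY K_sub k Z unfolding theta_iff by blast
  then show "(X \<inter> Z, Y \<inter> Z) \<in> theta d"
    using XY k Z by (simp add: theta_iff) blast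
  show "(jn X Z, jn Y Z) \<in> theta d"
  proof (cases "X = Y")
    case True then show ?thesis using k Z by (simp add: theta_iff)
  next
    case False
    then have XY': "X \<inter> I = Y \<inter> I" "\<And>q. q \<in> Q \<Longrightarrow> \<not> ord q d \<Longrightarrow> b q \<in> X \<longleftrightarrow> b q \<in> Y"
      using XY by (auto simp: theta_iff)
    define H where "H = hull ((X \<union> Z) \<inter> I)"
    have H: "H = hull ((Y \<union> Z) \<inter> I)" using XY'(1) by (simp add: H_def Int_Un_distrib2)
    show ?thesis
    proof (cases "H = I")
      case True
      then show ?thesis using jn_eq[OF k(1) Z] jn_eq[OF k(2) Z] H H_def E_in_K
        by (simp add: theta_iff)
    next
      case False
      have HI: "H \<subseteq> I" unfolding H_def by (rule C_sub[OF hull_C]) blast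
      have tr: "jn X Z \<inter> I = H" "jn Y Z \<inter> I = H"
        using jn_trace k Z H H_def by auto
      have mem: "b p \<in> jn W Z \<longleftrightarrow> p \<in> H \<and> (\<exists>q\<in>Q. ord p q \<and> b q \<in> W \<union> Z)"
        if "p \<in> Q" "W \<in> K" "H = hull ((W \<union> Z) \<inter> I)" for p W
      proof -
        have "b p \<notin> H" using b_notin[OF that(1)] HI by blast
        then show ?thesis
          using that(1) False unfolding jn_eq[OF that(2) Z] that(3)[symmetric]
          by simp (blast dest: inj_onD[OF inj_b])
      qed
      have "b p \<in> jn X Z \<longleftrightarrow> b p \<in> jn Y Z" if p: "p \<in> Q" "\<not> ord p d" for p
      proof -
        have "b q \<in> X \<longleftrightarrow> b q \<in> Y" if "q \<in> Q" "ord p q" for q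
          using XY'(2)[OF that(1)] ord_trans[OF p(1) that(1) d that(2)] p(2) by blast
        then show ?thesis
          using mem[OF p(1) k(1) H_def] mem[OF p(1) k(2) H] by blast
      qed
      moreover have "jn X Z \<noteq> E" "jn Y Z \<noteq> E" using tr False I_E by auto
      ultimately show ?thesis using tr k Z by (simp add: theta_iff)
    qed
  qed
next
  fix X Y assume "(X, Y) \<in> theta d"
  then show "(Y, X) \<in> theta d" by (cases "X = Y") (simp_all add: theta_def)
next
  fix X Y Z assume XY: "(X, Y) \<in> theta d" and YZ: "(Y, Z) \<in> theta d"
  show "(X, Z) \<in> theta d"
  proof (cases "X = Y \<or> Y = Z")
    case True then show ?thesis using XY YZ by blast
  next
    case False
    then show ?thesis using XY YZ by (simp add: theta_def)
  qed
next
  show "theta d \<subseteq> K \<times> K" unfolding theta_def by blast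
next
  fix X assume "X \<in> K"
  then show "(X, X) \<in> theta d" by (simp add: theta_def)
qed

text \<open>Meeting with an atom gives \<open>{} ~ {i}\<close>. If \<open>i\<close> is not
  \<open>z\<close>, joining with \<open>{z}\<close> gives \<open>{z} ~ E\<close>, meeting back
  collapses every other atom to the bottom, and \<open>{u}\<close>, \<open>{v}\<close> then join to
  \<open>E\<close>. If \<open>i = z\<close>, joining with other atoms gives \<open>{w} ~ E\<close>,
  and meeting \<open>{u} ~ E\<close> with \<open>{v}\<close> brings \<open>{v}\<close> down to the
  bottom. Either way \<open>{} ~ E\<close>.\<close>

lemma cg_total:
  assumes R: "cg R" and X: "X \<in> K" "X \<noteq> {}" "({}, X) \<in> R"
  shows "R = K \<times> K"
proof -
  note R' = cgD[OF R]
  have *: "R = K \<times> K" if "({}, E) \<in> R"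
  proof -
    have 0: "({}, Y) \<in> R" if "Y \<in> K" for Y
      using R'(7)[OF \<open>({}, E) \<in> R\<close> that] K_sub[OF that] by (simp add: Int_absorb1)
    have "(Y, Z) \<in> R" if "Y \<in> K" "Z \<in> K" for Y Z
      by (rule R'(5)[OF R'(4)[OF 0[OF that(1)]] 0[OF that(2)]])
    then have "K \<times> K \<subseteq> R" by auto
    moreover have "R \<subseteq> K \<times> K" by (rule subrelI) (simp add: R'(1,2))
    ultimately show ?thesis by simp
  qed
  have uv: "jn {u} {v} = E"
  proof -
    have J: "jn {u} {v} \<in> K" using zuv single_K by simp
    have "jn {u} {v} \<inter> I = I"
      using C_uv[OF KD(1)[OF J]] zuv jn_upper(1)[of "{u}" "{v}"] jn_upper(2)[of "{v}" "{u}"] by simp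
    then show ?thesis by (rule KD(4)[OF J])
  qed
  have zj: "jn Y {z} = E" if "Y \<in> K" "i \<in> Y" "i \<in> I" "i \<noteq> z" for Y i
  proof -
    have J: "jn Y {z} \<in> K" using that single_K zuv by simp
    have "z \<in> jn Y {z} \<inter> I" "i \<in> jn Y {z} \<inter> I"
      using zuv(1) that(2,3) jn_upper(1)[of Y "{z}"] jn_upper(2)[of "{z}" Y] by auto
    then have "jn Y {z} \<inter> I = I" using C_z[OF KD(1)[OF J]] that(4) by auto
    then show ?thesis by (rule KD(4)[OF J])
  qed
  show ?thesis
  proof (cases "X = E")
    case True then show ?thesis using * X by simp
  next
    case False
    \<comment> \<open>A marker never occurs without its point, so a nonempty closed set contains a
      point.\<close>
    obtain i where i: "i \<in> X" "i \<in> I" using X KD(2,5)[OF X(1)] Q_sub by blast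
    have i0: "({}, {i}) \<in> R" using R'(7)[OF X(3) single_K[OF i(2)]] i by (simp add: Int_absorb1)
    have j0: "jn {} {w} = {w}" if "w \<in> I" for w
      by (rule jn_absorb[OF single_K[OF that]]) simp
    have E0: "E \<inter> {w} = {w}" if "w \<in> I" for w using that I_E by blast
    show ?thesis
    proof (cases "i = z")
      case False
      have zE: "({z}, E) \<in> R"
        using R'(6)[OF i0 single_K[OF zuv(1)]] zj[OF single_K, of i i] i False
        by (simp add: j0 zuv(1))
      have w: "({}, {w}) \<in> R" if "w \<in> I" "w \<noteq> z" for w
        using R'(7)[OF zE single_K[OF that(1)]] that by (simp add: E0)
      have "({v}, E) \<in> R"
        using R'(6)[OF w[of u] single_K[OF zuv(3)]] zuv j0 uv by simp
      then show ?thesis by (rule *[OF R'(5)[OF w[OF zuv(3,5)]]])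
    next
      case True
      have w: "({w}, E) \<in> R" if "w \<in> I" "w \<noteq> z" for w
        using R'(6)[OF i0 single_K[OF that(1)]] True zj[OF single_K, of w w] that
        by (simp add: jn_commute[of "{z}"] j0)
      have "({}, {v}) \<in> R"
        using R'(7)[OF w[of u] single_K[OF zuv(3)]] zuv by (simp add: E0)
      then show ?thesis by (rule *[OF R'(5)[OF _ w[OF zuv(3,5)]]])
    qed
  qed
qed

text \<open>Meeting the pair with the atom of a point in which the traces differ identifies that
  atom with the bottom.\<close>

lemma cg_total_trace:
  assumes R: "cg R" and XY: "(X, Y) \<in> R" and ne: "X \<inter> I \<noteq> Y \<inter> I"
  shows "R = K \<times> K"
proof -
  note R' = cgD[OF R]
  have *: "R = K \<times> K" if "(X, Y) \<in> R" "i \<in> X" "i \<notin> Y" "i \<in> I" for X Y i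
    using R'(4)[OF R'(7)[OF that(1) single_K[OF that(4)]]] that
    by (intro cg_total[OF R single_K[OF that(4)]]) simp_all
  from ne consider i where "i \<in> X" "i \<notin> Y" "i \<in> I" | i where "i \<in> Y" "i \<notin> X" "i \<in> I"
    by blast
  then show ?thesis using *[OF XY] *[OF R'(4)[OF XY]] by cases
qed

text \<open>The collapse at \<open>d\<close> spreads to the interval of each \<open>s\<close> below
  \<open>d\<close>. Any pair of \<open>theta d\<close> is then reached by adding, in one join, the
  largest marker in which the two sets differ.\<close>

lemma cg_theta_sub:
  assumes R: "cg R" and d: "d \<in> Q" and dR: "({d}, {d, b d}) \<in> R"
  shows "theta d \<subseteq> R"
proof -
  note R' = cgD[OF R]
  have dI: "d \<in> I" using d Q_sub by blast
  have below: "({s}, {s, b s}) \<in> R" if s: "s \<in> Q" "ord s d" for s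
  proof (cases "s = d")
    case False
    have sI: "s \<in> I" using s Q_sub by blast
    obtain S where S: "S \<in> C" "S \<noteq> I" "s \<in> S" "d \<in> S" using C_ord[OF s(1) d s(2)] by blast
    \<comment> \<open>Joining with \<open>{s}\<close> makes \<open>b d\<close> force
      \<open>b s\<close> on the right. On the left the join stays inside the proper closed set
      \<open>S\<close>, which consists of points only, so \<open>b s\<close> is absent; meeting with
      \<open>{s, b s}\<close> isolates this difference.\<close>
    have "(jn {d} {s} \<inter> {s, b s}, jn {d, b d} {s} \<inter> {s, b s}) \<in> R"
      by (intro R'(6,7) dR single_K pair_K sI s)
    moreover have J: "s \<in> jn {d, b d} {s}" "b d \<in> jn {d, b d} {s}" "s \<in> jn {d} {s}"
      using jn_upper(1)[of "{d, b d}" "{s}"] jn_upper(2)[of "{s}" "{d, b d}"] jn_upper(2)[of "{s}" "{d}"]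
      by simp_all
    moreover have "b s \<in> jn {d, b d} {s}"
      by (rule KD(3)[OF _ s(1) d s(2) J(2,1)]) (simp add: pair_K[OF d] single_K[OF sI])
    moreover have "b s \<notin> jn {d} {s}"
    proof
      assume "b s \<in> jn {d} {s}"
      also have "jn {d} {s} \<subseteq> S" by (rule jn_least[OF C_K[OF S(1,2)]]) (simp_all add: S)
      finally have "b s \<in> I" using C_sub[OF S(1)] by blast
      then show False using b_notin[OF s(1)] by simp
    qed
    ultimately show ?thesis by (simp add: Int_insert_right)
  qed (use dR in simp)
  have sub: "(X, Y) \<in> R" if XY: "(X, Y) \<in> theta d" "X \<subseteq> Y" for X Y
  proof (cases "X = Y")
    case True then show ?thesis using XY R'(3) by (auto simp: theta_iff)
  next
    case False
    then have k: "X \<in> K" "Y \<in> K" "X \<noteq> E" "X \<inter> I = Y \<inter> I"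
      "\<And>q. q \<in> Q \<Longrightarrow> \<not> ord q d \<Longrightarrow> b q \<in> X \<longleftrightarrow> b q \<in> Y" using XY by (auto simp: theta_iff)
    \<comment> \<open>The greatest \<open>m\<close> in \<open>D\<close> does all the work: once
      \<open>b m\<close> is added to \<open>X\<close>, the downward rule for markers forces all
      others in \<open>D\<close>, because their points lie in \<open>X\<close> already.\<close>
    define D where "D = {q \<in> Q. b q \<in> Y - X}"
    have bD: "b ` D = Y - X"
    proof
      show "Y - X \<subseteq> b ` D"
        using KD(5)[OF k(2)] k(4) unfolding D_def by blast
    qed (auto simp: D_def)
    have DX: "D \<subseteq> (X \<inter> I) \<inter> Q"
      using KD(2)[OF k(2)] k(4) Q_sub unfolding D_def by blast
    moreover have "D \<noteq> {}" using bD False XY(2) by blast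
    moreover have "X \<inter> I \<noteq> I" using KD(4)[OF k(1)] k(3) by blast
    ultimately have "\<exists>d\<in>D. \<forall>d'\<in>D. ord d' d" by (intro C_greatest[OF KD(1)[OF k(1)]])
    then obtain m where m: "m \<in> D" "\<And>q. q \<in> D \<Longrightarrow> ord q m" by auto
    have mQ: "m \<in> Q" "m \<in> X" "m \<in> I" using m DX by auto
    have "ord m d" using k(5)[of m] m(1) unfolding D_def by blast
    from R'(6)[OF below[OF mQ(1) this] k(1)]
    have "(jn {m} X, jn {m, b m} X) \<in> R" .
    moreover have "jn {m} X = X" using jn_absorb[OF k(1)] mQ by simp
    moreover have "jn {m, b m} X = Y"
    proof
      have "{m, b m} \<subseteq> Y" using m(1) mQ(2) XY(2) by (auto simp: D_def)
      then show "jn {m, b m} X \<subseteq> Y" by (rule jn_least[OF k(2) _ XY(2)])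
      have "b q \<in> jn {m, b m} X" if "q \<in> D" for q
      proof (rule KD(3)[OF jn_in[OF pair_K[OF mQ(1)] k(1)] _ mQ(1) m(2)[OF that]])
        show "q \<in> Q" using that DX by blast
        show "b m \<in> jn {m, b m} X" using jn_upper(1)[of "{m, b m}" X] by simp
        show "q \<in> jn {m, b m} X" using that DX jn_upper(2)[of X "{m, b m}"] by blast
      qed
      then have "b ` D \<subseteq> jn {m, b m} X" by (rule image_subsetI)
      moreover have "Y = X \<union> b ` D" using bD XY(2) by blast
      ultimately show "Y \<subseteq> jn {m, b m} X" using jn_upper(2)[of X "{m, b m}"] by simp
    qed
    ultimately show ?thesis by simp
  qed
  show ?thesis
  proof (clarify)
    fix X Y assume XY: "(X, Y) \<in> theta d"
    \<comment> \<open>An arbitrary pair is reduced to two comparable ones through the meet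
      \<open>X \<inter> Y\<close>.\<close>
    note T = cgD[OF theta_cg[OF d]]
    have "(X \<inter> Y, X) \<in> theta d" "(X \<inter> Y, Y) \<in> theta d"
      using T(4)[OF T(7)[OF XY T(1)[OF XY]]] T(7)[OF XY T(2)[OF XY]]
      by (simp_all add: Int_commute)
    then have "(X \<inter> Y, X) \<in> R" "(X \<inter> Y, Y) \<in> R" by (simp_all add: sub)
    then show "(X, Y) \<in> R" by (rule R'(5)[OF R'(4)])
  qed
qed

lemma pair_theta:
  assumes "d \<in> Q" "p \<in> Q" shows "({d}, {d, b d}) \<in> theta p \<longleftrightarrow> ord d p"
proof -
  have dI: "d \<in> I" using assms Q_sub by blast
  have bI: "b q \<noteq> d" if "q \<in> Q" for q using b_notin[OF that] dI by blast
  have tr: "{d} \<inter> I = {d}" "{d, b d} \<inter> I = {d}" using dI b_notin[OF assms(1)] by simp_all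
  have ne: "{d} \<noteq> E" "{d, b d} \<noteq> E" using tr proper_single[of d] I_E by auto
  have nx: "{d} \<noteq> {d, b d}" using bI[OF assms(1)] by simp
  show ?thesis
  proof
    assume "({d}, {d, b d}) \<in> theta p"
    then have "\<not> ord d p \<longrightarrow> (b d \<in> {d} \<longleftrightarrow> b d \<in> {d, b d})"
      using nx assms(1) unfolding theta_iff by blast
    then show "ord d p" using bI[OF assms(1)] by simp
  next
    assume o: "ord d p"
    have "\<forall>q\<in>Q. \<not> ord q p \<longrightarrow> (b q \<in> {d} \<longleftrightarrow> b q \<in> {d, b d})"
      using o bI b_eq assms(1) by auto
    then show "({d}, {d, b d}) \<in> theta p"
      unfolding theta_iff using tr ne single_K[OF dI] pair_K[OF assms(1)] by simp
  qed
qed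

lemma con_theta:
  assumes "d \<in> Q" shows "con lat (e ` {d}) (e ` {d, b d}) = lift (theta d)"
  using assms by (intro con_lat theta_cg cg_theta_sub) (simp_all add: pair_theta ord_refl)

lemma total_cg: "cg (K \<times> K)"
  by (rule cgI) auto

lemma Id_cg: "cg (Id_on K)"
  by (rule cgI) auto

text \<open>Equal sets generate the identity and different traces generate everything. With equal
  traces the sets differ only in markers, and the largest of these determines the
  congruence.\<close>

lemma con_cases:
  assumes X: "X \<in> K" and Y: "Y \<in> K"
  shows "con lat (e ` X) (e ` Y) \<in> lift ` ({Id_on K, K \<times> K} \<union> theta ` Q)"
proof -
  consider "X = Y" | "X \<inter> I \<noteq> Y \<inter> I" | "X \<noteq> Y" "X \<inter> I = Y \<inter> I" by blast
  then show ?thesis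
  proof cases
    case 1
    have "con lat (e ` X) (e ` Y) = lift (Id_on K)"
      using 1 X cgD(3) by (intro con_lat Id_cg) auto
    then show ?thesis by simp
  next
    case 2
    have "con lat (e ` X) (e ` Y) = lift (K \<times> K)"
      using X Y cg_total_trace[OF _ _ 2] by (intro con_lat total_cg) auto
    then show ?thesis by simp
  next
    case 3
    have nE: "X \<inter> I \<noteq> I" using 3 KD(4)[OF X] KD(4)[OF Y] by auto
    \<comment> \<open>The sets need not be comparable, so \<open>D\<close> is the symmetric
      difference of their markers. Its greatest element exists because the common trace is a proper
      closed set.\<close>
    define D where "D = {q \<in> Q. b q \<in> X \<longleftrightarrow> b q \<notin> Y}"
    have "D \<noteq> {}" using 3 KD(5)[OF X] KD(5)[OF Y] unfolding D_def by blast
    moreover have DX: "D \<subseteq> (X \<inter> I) \<inter> Q"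
      using KD(2)[OF X] KD(2)[OF Y] 3 Q_sub unfolding D_def by blast
    ultimately have "\<exists>d\<in>D. \<forall>d'\<in>D. ord d' d" by (intro C_greatest[OF KD(1)[OF X] nE])
    then obtain d where d: "d \<in> D" "\<And>q. q \<in> D \<Longrightarrow> ord q d" by auto
    have dQ: "d \<in> Q" "d \<in> X" "d \<in> Y" "b d \<in> X \<longleftrightarrow> b d \<notin> Y" using d DX 3 by (auto simp: D_def)
    have "con lat (e ` X) (e ` Y) = lift (theta d)"
    proof (rule con_lat[OF theta_cg[OF dQ(1)]])
      show "(X, Y) \<in> theta d"
        using X Y 3 nE I_E d unfolding theta_iff D_def by auto
      fix S assume S: "cg S" and XY: "(X, Y) \<in> S"
      \<comment> \<open>Exactly one of the two sets contains \<open>b d\<close> while both contain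
        \<open>d\<close>, so this meet is the prime interval of \<open>d\<close>, in one order or
        the other.\<close>
      have "(X \<inter> {d, b d}, Y \<inter> {d, b d}) \<in> S"
        by (rule cgD(7)[OF S XY pair_K[OF dQ(1)]])
      then have "({d}, {d, b d}) \<in> S"
        using dQ(2,3,4) cgD(4)[OF S, of "{d, b d}" "{d}"] by (cases "b d \<in> X") (simp_all add: Int_insert_right)
      then show "theta d \<subseteq> S" by (rule cg_theta_sub[OF S dQ(1)])
    qed
    then show ?thesis using dQ by blast
  qed
qed

lemma Princ_lat: "Princ lat = lift ` ({Id_on K, K \<times> K} \<union> theta ` Q)"
proof
  show "Princ lat \<subseteq> lift ` ({Id_on K, K \<times> K} \<union> theta ` Q)"
    unfolding Princ_def using con_cases by auto
  have P: "con lat (e ` X) (e ` Y) \<in> Princ lat" if "X \<in> K" "Y \<in> K" for X Y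
    using that unfolding Princ_def by auto
  have "con lat (e ` {}) (e ` {}) = lift (Id_on K)"
    using empty_K cgD(3) by (intro con_lat Id_cg) auto
  moreover have "con lat (e ` {}) (e ` {z}) = lift (K \<times> K)"
    using cg_total[OF _ single_K[OF zuv(1)]] empty_K single_K[OF zuv(1)]
    by (intro con_lat total_cg) auto
  moreover have "lift (theta d) \<in> Princ lat" if "d \<in> Q" for d
    using P[OF single_K pair_K, of d d] con_theta[OF that] that Q_sub by auto
  ultimately show "lift ` ({Id_on K, K \<times> K} \<union> theta ` Q) \<subseteq> Princ lat"
    using P[OF empty_K empty_K] P[OF empty_K single_K[OF zuv(1)]] by auto
qed

lemma theta_mono:
  assumes "p \<in> Q" "q \<in> Q" shows "theta p \<subseteq> theta q \<longleftrightarrow> ord p q"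
proof
  assume "theta p \<subseteq> theta q"
  then show "ord p q" using pair_theta assms ord_refl by blast
next
  assume "ord p q"
  then show "theta p \<subseteq> theta q"
    using cg_theta_sub[OF theta_cg[OF assms(2)] assms(1)] pair_theta assms by blast
qed

lemma theta_bounds:
  assumes "d \<in> Q"
  shows "Id_on K \<subseteq> theta d" "theta d \<subseteq> K \<times> K" "\<not> theta d \<subseteq> Id_on K" "\<not> K \<times> K \<subseteq> theta d"
proof -
  show "Id_on K \<subseteq> theta d" "theta d \<subseteq> K \<times> K" by (auto simp: theta_iff)
  have "({d}, {d, b d}) \<in> theta d" using pair_theta assms ord_refl by blast
  moreover have "({d}, {d, b d}) \<notin> Id_on K" using b_notin[OF assms] assms Q_sub by (auto simp: Id_on_def)
  ultimately show "\<not> theta d \<subseteq> Id_on K" by blast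
  have "({}, {z}) \<notin> theta d" using zuv by (auto simp: theta_iff)
  then show "\<not> K \<times> K \<subseteq> theta d" using empty_K single_K[OF zuv(1)] by blast
qed

lemma Id_total: "\<not> K \<times> K \<subseteq> Id_on K"
  using empty_K single_K[OF zuv(1)] by auto

section \<open>Automorphisms as permutations of the points\<close>

text \<open>The singletons of points are the atoms of \<open>K\<close>, since every nonempty closed
  set contains a point. An automorphism permutes them, and the traces of joins of two atoms are the
  hulls of pairs.\<close>

lemma order_aut_points:
  assumes h: "order_aut h"
  obtains \<pi> where "bij_betw \<pi> I I" "\<And>i. i \<in> I \<Longrightarrow> h {i} = {\<pi> i}"
    "\<And>X i. X \<in> K \<Longrightarrow> i \<in> I \<Longrightarrow> \<pi> i \<in> h X \<longleftrightarrow> i \<in> X"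
    "\<And>i j k. i \<in> I \<Longrightarrow> j \<in> I \<Longrightarrow> k \<in> I \<Longrightarrow> \<pi> k \<in> hull {\<pi> i, \<pi> j} \<longleftrightarrow> k \<in> hull {i, j}"
proof -
  note le = order_autD(2)[OF h]
  have im: "h ` K = K" and inj: "inj_on h K" using order_autD(1)[OF h] by (simp_all add: bij_betw_def)
  have hK: "h X \<in> K" if "X \<in> K" for X using im that by blast
  have pre: "\<exists>X\<in>K. h X = Y" if "Y \<in> K" for Y
  proof -
    have "Y \<in> h ` K" using im that by simp
    then show ?thesis by auto
  qed
  have point: "\<exists>i\<in>I. i \<in> X" if X: "X \<in> K" "X \<noteq> {}" for X
  proof -
    obtain x where x: "x \<in> X" using X by blast
    show ?thesis
    proof (cases "x \<in> I")
      case False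
      then obtain q where "q \<in> Q" "x = b q" using KD(5)[OF X(1) x] by blast
      then have "q \<in> X" "q \<in> I" using KD(2)[OF X(1)] x Q_sub by auto
      then show ?thesis by blast
    qed (use x in blast)
  qed
  have h0: "h {} = {}"
  proof -
    obtain X where "X \<in> K" "h X = {}" using pre[OF empty_K] by blast
    then show ?thesis using le[OF empty_K, of X] by simp
  qed
  have ne: "h X \<noteq> {}" if "X \<in> K" "X \<noteq> {}" for X
    using inj_on_eq_iff[OF inj that(1) empty_K] that h0 by simp
  have atom: "\<exists>j\<in>I. h {i} = {j}" if i: "i \<in> I" for i
  proof -
    obtain j where j: "j \<in> I" "j \<in> h {i}"
      using point[OF hK[OF single_K[OF i]] ne[OF single_K[OF i]]] by auto
    obtain X where X: "X \<in> K" "h X = {j}" using pre[OF single_K[OF j(1)]] by blast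
    have "X \<subseteq> {i}" using le[OF X(1) single_K[OF i]] X j by simp
    moreover have "X \<noteq> {}" using X h0 by auto
    ultimately have "X = {i}" by blast
    then show ?thesis using X j by blast
  qed
  define \<pi> where "\<pi> i = the_elem (h {i})" for i
  have hp: "h {i} = {\<pi> i}" and pI: "\<pi> i \<in> I" if "i \<in> I" for i
  proof -
    obtain j where j: "j \<in> I" "h {i} = {j}" using atom[OF \<open>i \<in> I\<close>] by blast
    then have "\<pi> i = j" by (simp add: \<pi>_def)
    then show "h {i} = {\<pi> i}" "\<pi> i \<in> I" using j by simp_all
  qed
  have mem: "\<pi> i \<in> h X \<longleftrightarrow> i \<in> X" if "X \<in> K" "i \<in> I" for X i
    using le[OF single_K[OF that(2)] that(1)] hp[OF that(2)] by simp
  have "inj_on \<pi> I"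
  proof (rule inj_onI)
    fix i j assume ij: "i \<in> I" "j \<in> I" "\<pi> i = \<pi> j"
    then have "h {i} = h {j}" using hp by simp
    then show "i = j" using inj_on_eq_iff[OF inj single_K[OF ij(1)] single_K[OF ij(2)]] by simp
  qed
  moreover have "\<pi> ` I = I"
  proof
    show "I \<subseteq> \<pi> ` I"
    proof
      fix j assume j: "j \<in> I"
      obtain X where X: "X \<in> K" "h X = {j}" using pre[OF single_K[OF j]] by blast
      then have "X \<noteq> {}" using h0 by auto
      then obtain i where i: "i \<in> I" "i \<in> X" using point X by blast
      then have "\<pi> i \<in> h X" using mem[OF X(1) i(1)] by simp
      then show "j \<in> \<pi> ` I" using X i by auto
    qed
  qed (use pI in blast)
  ultimately have "bij_betw \<pi> I I" by (simp add: bij_betw_def)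
  moreover have "\<pi> k \<in> hull {\<pi> i, \<pi> j} \<longleftrightarrow> k \<in> hull {i, j}" if "i \<in> I" "j \<in> I" "k \<in> I" for i j k
  proof -
    have hu: "jn {i} {j} \<inter> I = hull {i, j}" if "i \<in> I" "j \<in> I" for i j
      using jn_trace[OF single_K[OF that(1)] single_K[OF that(2)]] that by (simp add: insert_commute)
    have "\<pi> k \<in> h (jn {i} {j}) \<longleftrightarrow> k \<in> jn {i} {j}"
      by (rule mem[OF jn_in[OF single_K[OF that(1)] single_K[OF that(2)]] that(3)])
    moreover have "h (jn {i} {j}) = jn {\<pi> i} {\<pi> j}"
      using order_aut_jn_Int(1)[OF h single_K[OF that(1)] single_K[OF that(2)]] hp that by simp
    ultimately show ?thesis
      using hu[OF that(1,2), symmetric] hu[OF pI pI, symmetric] pI that by simp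
  qed
  ultimately show ?thesis using hp mem by (intro that)
qed

text \<open>Once the points of \<open>Q\<close> are fixed, the markers have no freedom left:
  \<open>{q}\<close> and \<open>{q, b q}\<close> are the only closed sets with trace
  \<open>{q}\<close>. So \<open>h\<close> fixes \<open>{q, b q}\<close>, and this set lies below a
  closed set exactly when that set contains \<open>b q\<close>.\<close>

lemma order_aut_eq_image:
  assumes h: "order_aut h" and \<pi>: "bij_betw \<pi> I I" "\<And>i. i \<in> I \<Longrightarrow> h {i} = {\<pi> i}"
    "\<And>X i. X \<in> K \<Longrightarrow> i \<in> I \<Longrightarrow> \<pi> i \<in> h X \<longleftrightarrow> i \<in> X"
    and \<alpha>: "\<And>i. i \<in> I \<Longrightarrow> \<alpha> i = \<pi> i" "\<And>q. q \<in> Q \<Longrightarrow> \<alpha> q = q" "\<And>q. q \<in> Q \<Longrightarrow> \<alpha> (b q) = b q"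
    and X: "X \<in> K"
  shows "h X = \<alpha> ` X"
proof -
  note bij = order_autD(1)[OF h] and le = order_autD(2)[OF h]
  have hK: "h X \<in> K" if "X \<in> K" for X using bij that by (blast dest: bij_betwE)
  have tr: "h X \<inter> I = \<pi> ` (X \<inter> I)" if X: "X \<in> K" for X
  proof
    show "\<pi> ` (X \<inter> I) \<subseteq> h X \<inter> I" using \<pi>(3)[OF X] bij_betwE[OF \<pi>(1)] by auto
    show "h X \<inter> I \<subseteq> \<pi> ` (X \<inter> I)"
    proof
      fix j assume j: "j \<in> h X \<inter> I"
      then have "j \<in> \<pi> ` I" using \<pi>(1) by (simp add: bij_betw_def)
      then obtain i where "i \<in> I" "j = \<pi> i" by blast
      then show "j \<in> \<pi> ` (X \<inter> I)" using \<pi>(3)[OF X] j by auto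
    qed
  qed
  have pq: "\<pi> q = q" if "q \<in> Q" for q using \<alpha>(1)[of q] \<alpha>(2)[OF that] that Q_sub by auto
  have pair: "h {q, b q} = {q, b q}" if q: "q \<in> Q" for q
  proof -
    have qI: "q \<in> I" using q Q_sub by blast
    have t: "h {q, b q} \<inter> I = {q}"
      using tr[OF pair_K[OF q]] b_notin[OF q] qI pq[OF q] by simp
    \<comment> \<open>The image has trace \<open>{q}\<close> but differs from \<open>{q}\<close>, so
      it contains a marker, and the trace allows only \<open>b q\<close>.\<close>
    have "h {q, b q} \<noteq> h {q}"
      using inj_on_eq_iff[OF bij_betw_imp_inj_on[OF bij] pair_K[OF q] single_K[OF qI]]
        b_notin[OF q] qI by auto
    then have "h {q, b q} \<noteq> {q}" using \<pi>(2)[OF qI] pq[OF q] by simp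
    then obtain x where x: "x \<in> h {q, b q}" "x \<notin> I" using t by blast
    have "y = b q" if y: "y \<in> h {q, b q}" "y \<notin> I" for y
    proof -
      obtain r where r: "r \<in> Q" "y = b r" using KD(5)[OF hK[OF pair_K[OF q]] y] by blast
      then have "r \<in> h {q, b q} \<inter> I" using KD(2)[OF hK[OF pair_K[OF q]] r(1)] y Q_sub by blast
      then show ?thesis using t r by simp
    qed
    then show ?thesis using x t by blast
  qed
  have bm: "b q \<in> h X \<longleftrightarrow> b q \<in> X" if q: "q \<in> Q" for q
  proof -
    have *: "b q \<in> Y \<longleftrightarrow> {q, b q} \<subseteq> Y" if "Y \<in> K" for Y using KD(2)[OF that q] by blast
    show ?thesis
      unfolding *[OF X] *[OF hK[OF X]] using le[OF pair_K[OF q] X] pair[OF q] by simp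
  qed
  have split: "Y = (Y \<inter> I) \<union> b ` {q \<in> Q. b q \<in> Y}" if "Y \<in> K" for Y
    using KD(5)[OF that] by blast
  have "\<alpha> ` X = \<alpha> ` (X \<inter> I) \<union> \<alpha> ` b ` {q \<in> Q. b q \<in> X}"
    by (subst split[OF X]) (rule image_Un)
  also have "\<alpha> ` (X \<inter> I) = h X \<inter> I" using tr[OF X] \<alpha>(1) by (simp add: image_def)
  also have "\<alpha> ` b ` {q \<in> Q. b q \<in> X} = b ` {q \<in> Q. b q \<in> h X}"
  proof -
    have "\<alpha> ` b ` {q \<in> Q. b q \<in> X} = b ` {q \<in> Q. b q \<in> X}"
      using \<alpha>(3) by (simp add: image_image)
    moreover have "{q \<in> Q. b q \<in> X} = {q \<in> Q. b q \<in> h X}" using bm by blast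
    ultimately show ?thesis by simp
  qed
  also have "(h X \<inter> I) \<union> b ` {q \<in> Q. b q \<in> h X} = h X" by (rule split[OF hK[OF X], symmetric])
  finally show ?thesis by simp
qed

lemma image_K:
  assumes \<alpha>: "bij_betw \<alpha> I I" "\<And>q. q \<in> Q \<Longrightarrow> \<alpha> q = q" "\<And>q. q \<in> Q \<Longrightarrow> \<alpha> (b q) = b q"
    "\<And>S. S \<in> C \<Longrightarrow> \<alpha> ` S \<in> C" and X: "X \<in> K"
  shows "\<alpha> ` X \<in> K"
proof -
  have inI: "\<alpha> x \<in> I \<longleftrightarrow> x \<in> I" if "x \<in> X" for x
  proof (cases "x \<in> I")
    case False
    then obtain q where "q \<in> Q" "x = b q" using KD(5)[OF X \<open>x \<in> X\<close>] by blast
    then show ?thesis using \<alpha>(3) by simp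
  qed (use bij_betwE[OF \<alpha>(1)] in simp)
  have tr: "\<alpha> ` X \<inter> I = \<alpha> ` (X \<inter> I)" using inI by blast
  have bx: "b q \<in> \<alpha> ` X \<longleftrightarrow> b q \<in> X" if q: "q \<in> Q" for q
  proof
    assume "b q \<in> \<alpha> ` X"
    then obtain x where x: "x \<in> X" "b q = \<alpha> x" by blast
    then have "x \<notin> I" using inI[OF x(1)] b_notin[OF q] by simp
    then obtain r where "r \<in> Q" "x = b r" using KD(5)[OF X x(1)] by blast
    then show "b q \<in> X" using x \<alpha>(3) by simp
  next
    assume "b q \<in> X" then show "b q \<in> \<alpha> ` X" using \<alpha>(3)[OF q] by (metis imageI)
  qed
  have qx: "q \<in> \<alpha> ` X \<longleftrightarrow> q \<in> X" if q: "q \<in> Q" for q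
  proof
    assume "q \<in> \<alpha> ` X"
    then obtain x where x: "x \<in> X" "q = \<alpha> x" by blast
    have qI: "q \<in> I" using q Q_sub by blast
    then have "x \<in> I" using inI[OF x(1)] x by simp
    then have "x = q"
      using inj_on_eq_iff[OF bij_betw_imp_inj_on[OF \<alpha>(1)] _ qI, of x] \<alpha>(2)[OF q] x by simp
    then show "q \<in> X" using x by simp
  next
    assume "q \<in> X" then show "q \<in> \<alpha> ` X" using \<alpha>(2)[OF q] by (metis imageI)
  qed
  show ?thesis
  proof (rule KI)
    show "\<alpha> ` X \<subseteq> E"
    proof (rule image_subsetI)
      fix x assume x: "x \<in> X"
      show "\<alpha> x \<in> E"
      proof (cases "x \<in> I")
        case False
        then obtain q where "q \<in> Q" "x = b q" using KD(5)[OF X x] by blast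
        then show ?thesis using \<alpha>(3) by (simp add: E_def)
      qed (use inI[OF x] I_E in blast)
    qed
    show "\<alpha> ` X \<inter> I \<in> C" using tr \<alpha>(4)[OF KD(1)[OF X]] by simp
    show "q \<in> \<alpha> ` X" if "q \<in> Q" "b q \<in> \<alpha> ` X" for q
      using KD(2)[OF X that(1)] that bx qx by simp
    show "b p \<in> \<alpha> ` X" if "p \<in> Q" "q \<in> Q" "ord p q" "b q \<in> \<alpha> ` X" "p \<in> \<alpha> ` X" for p q
      using KD(3)[OF X that(1,2,3)] that bx qx by simp
    show "\<alpha> ` X = E" if "I \<subseteq> \<alpha> ` X"
    proof -
      have "\<alpha> ` (X \<inter> I) = \<alpha> ` I" using that tr \<alpha>(1) by (simp add: bij_betw_def Int_absorb1)
      then have "X \<inter> I = I"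
        using inj_on_image_eq_iff[OF bij_betw_imp_inj_on[OF \<alpha>(1)], of "X \<inter> I" I] by simp
      then have XE: "X = E" by (rule KD(4)[OF X])
      have "\<alpha> ` b ` Q = b ` Q" using \<alpha>(3) by (simp add: image_image)
      then show ?thesis using XE \<alpha>(1) by (simp add: E_def image_Un bij_betw_def)
    qed
  qed
qed

lemma image_order_aut:
  assumes \<alpha>: "\<And>X. X \<in> K \<Longrightarrow> \<alpha> ` X \<in> K" and \<beta>: "\<And>X. X \<in> K \<Longrightarrow> \<beta> ` X \<in> K"
    and inv: "\<And>x. x \<in> E \<Longrightarrow> \<beta> (\<alpha> x) = x" "\<And>x. x \<in> E \<Longrightarrow> \<alpha> (\<beta> x) = x"
  shows "order_aut (image \<alpha>)"
proof -
  have ba: "\<beta> ` \<alpha> ` X = X" and ab: "\<alpha> ` \<beta> ` X = X" if "X \<in> K" for X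
  proof -
    have "\<beta> (\<alpha> x) = x" "\<alpha> (\<beta> x) = x" if "x \<in> X" for x
      using inv KD(6)[OF \<open>X \<in> K\<close>] that by auto
    then show "\<beta> ` \<alpha> ` X = X" "\<alpha> ` \<beta> ` X = X" by (simp_all add: image_image)
  qed
  have "bij_betw (image \<alpha>) K K"
    by (rule bij_betwI[where g = "image \<beta>"]) (use \<alpha> \<beta> ba ab in auto)
  moreover have "X \<subseteq> Y \<longleftrightarrow> \<alpha> ` X \<subseteq> \<alpha> ` Y" if "X \<in> K" "Y \<in> K" for X Y
  proof
    assume "\<alpha> ` X \<subseteq> \<alpha> ` Y"
    then have "\<beta> ` \<alpha> ` X \<subseteq> \<beta> ` \<alpha> ` Y" by (rule image_mono)
    then show "X \<subseteq> Y" using ba that by simp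
  qed (rule image_mono)
  ultimately show ?thesis unfolding order_aut_def by (intro conjI ballI)
qed

end

section \<open>The points and blocks of an ordered set and a group\<close>

text \<open>\<open>Pt p\<close> carries the marker \<open>Bt p\<close> and is made rigid by its private partner \<open>Rk p\<close>. \<open>Ma g\<close> and \<open>Mb g\<close>
  are two copies of the group that record the edges of its Cayley diagram, with colours \<open>Col s\<close>. The
  points \<open>Nu\<close> and \<open>Nv\<close> start the well-ordered set of the rigid points, and \<open>Zt\<close> is the isolated point.\<close>

datatype ('p, 'g) pt = Bt 'p | Pt 'p | Rk 'p | Col 'g | Ma 'g | Mb 'g | Nu | Nv | Zt

fun bt :: "('p, 'g) pt \<Rightarrow> ('p, 'g) pt" where
  "bt (Pt p) = Bt p"
| "bt x = x"

section \<open>The configuration of points and blocks\<close>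

locale poset_group =
  fixes P :: "'p gorder" and G :: "('g, 'm) monoid_scheme" (structure) and bo to :: 'p
    and lt :: "('p, 'g) pt \<Rightarrow> ('p, 'g) pt \<Rightarrow> bool" and e :: "('p, 'g) pt \<Rightarrow> 'b"
  assumes po: "partial_order P" and grp: "group G"
    and bo: "least P bo (carrier P)" and to: "greatest P to (carrier P)" and bo_to: "bo \<noteq> to"
    and wf_lt: "wfP lt" and lt_trans: "lt x y \<Longrightarrow> lt y w \<Longrightarrow> lt x w"
    and lt_total: "x \<noteq> y \<Longrightarrow> lt x y \<or> lt y x"
    and Nu_least: "x \<noteq> Nu \<Longrightarrow> lt Nu x" and Nv_least: "x \<noteq> Nu \<Longrightarrow> x \<noteq> Nv \<Longrightarrow> lt Nv x"
    and inj_code: "inj e"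
begin

interpretation group G by (rule grp)

interpretation P: partial_order P by (rule po)

definition P0 :: "'p set" where "P0 = carrier P - {bo, to}"

definition R :: "('p, 'g) pt set" where
  "R = Rk ` P0 \<union> Col ` carrier G \<union> {Nu, Nv}"

definition I :: "('p, 'g) pt set" where
  "I = R \<union> Pt ` P0 \<union> Ma ` carrier G \<union> Mb ` carrier G \<union> {Zt}"

definition ord :: "('p, 'g) pt \<Rightarrow> ('p, 'g) pt \<Rightarrow> bool" where
  "ord i j \<longleftrightarrow> (\<exists>p q. i = Pt p \<and> j = Pt q \<and> p \<sqsubseteq>\<^bsub>P\<^esub> q)"

definition W :: "('p, 'g) pt \<Rightarrow> ('p, 'g) pt set" where
  "W s = {t \<in> R. t = s \<or> lt t s}"

text \<open>\<open>pq\<close> spreads congruences from \<open>q\<close> to \<open>p\<close>,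
  \<open>rp\<close> ties each \<open>Pt p\<close> to a rigid partner, and \<open>W\<close> lists the
  initial segments that make \<open>R\<close> rigid. \<open>va\<close> marks the first copy of the
  group by the rigid point \<open>Nv\<close>, and \<open>abc\<close> lists the coloured
  edges.\<close>

inductive_set blocks :: "('p, 'g) pt set set" where
  pq: "p \<in> P0 \<Longrightarrow> q \<in> P0 \<Longrightarrow> p \<sqsubseteq>\<^bsub>P\<^esub> q \<Longrightarrow> {Pt p, Pt q} \<in> blocks"
| rp: "p \<in> P0 \<Longrightarrow> {Rk p, Pt p} \<in> blocks"
| W: "s \<in> R \<Longrightarrow> W s \<in> blocks"
| va: "g \<in> carrier G \<Longrightarrow> {Nv, Ma g} \<in> blocks"
| abc: "g \<in> carrier G \<Longrightarrow> s \<in> carrier G \<Longrightarrow> {Ma g, Mb (g \<otimes> s), Col s} \<in> blocks"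

definition faces :: "('p, 'g) pt set set" where
  "faces = blocks \<union> {{}} \<union> (\<lambda>i. {i}) ` I"

text \<open>This is the Moore family generated by the faces inside \<open>I\<close>. The factor
  \<open>I\<close> handles the empty intersection: a set contained in no face has closure
  \<open>I\<close>, so a proper closed set always lies in a face.\<close>

definition C :: "('p, 'g) pt set set" where
  "C = {S. S \<subseteq> I \<and> I \<inter> \<Inter>{B \<in> faces. S \<subseteq> B} \<subseteq> S}"

lemma W_R: "W s \<subseteq> R" by (auto simp: W_def)

lemma lt_irrefl: "\<not> lt x x"
  using wf_lt by (simp add: wfp_imp_irreflp irreflpD)

lemma R_simps [simp]: "Rk p \<in> R \<longleftrightarrow> p \<in> P0" "Col g \<in> R \<longleftrightarrow> g \<in> carrier G" "Nu \<in> R" "Nv \<in> R"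
  "Pt p \<notin> R" "Bt p \<notin> R" "Ma g \<notin> R" "Mb g \<notin> R" "Zt \<notin> R"
  by (auto simp: R_def)

lemma I_simps [simp]: "Rk p \<in> I \<longleftrightarrow> p \<in> P0" "Col g \<in> I \<longleftrightarrow> g \<in> carrier G" "Nu \<in> I" "Nv \<in> I"
  "Pt p \<in> I \<longleftrightarrow> p \<in> P0" "Bt p \<notin> I" "Ma g \<in> I \<longleftrightarrow> g \<in> carrier G" "Mb g \<in> I \<longleftrightarrow> g \<in> carrier G" "Zt \<in> I"
  by (auto simp: I_def)

lemma R_I: "R \<subseteq> I" by (auto simp: I_def)

lemma blocks_I: "B \<in> blocks \<Longrightarrow> B \<subseteq> I"
  by (erule blocks.cases) (use W_R R_I in auto)

lemma Zt_block: "B \<in> blocks \<Longrightarrow> Zt \<notin> B"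
  by (erule blocks.cases) (auto simp: W_def)

lemma faces_I: "B \<in> faces \<Longrightarrow> B \<subseteq> I"
  using blocks_I by (auto simp: faces_def)

lemma blocks_R: "B \<in> blocks \<Longrightarrow> B \<subseteq> R \<Longrightarrow> \<exists>s\<in>R. B = W s"
  by (erule blocks.cases) auto

text \<open>A block outside \<open>R\<close> has at most one point in \<open>R\<close>, so it cannot
  share two points with a block \<open>W s\<close>. For the edges of the Cayley diagram,
  cancellation in the group lets any two of the three points determine the third.\<close>

lemma blocks_unique:
  assumes "B \<in> blocks" "B' \<in> blocks" "\<not> B \<subseteq> R" "i \<in> B" "j \<in> B" "i \<in> B'" "j \<in> B'" "i \<noteq> j"
  shows "B = B'"
proof -
  have notR: False if "i \<in> R" "j \<in> R"
    using assms(1) by (cases rule: blocks.cases) (use that assms(3-5,8) W_R in auto)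
  show ?thesis
    using assms(2)
  proof (cases rule: blocks.cases)
    case (W s)
    then have "i \<in> R" "j \<in> R" using assms(6,7) W_R by auto
    then show ?thesis using notR by blast
  next
    case (pq p q)
    show ?thesis using assms(1)
      by (cases rule: blocks.cases) (use pq assms(3-8) W_R in auto)
  next
    case (rp p)
    show ?thesis using assms(1)
      by (cases rule: blocks.cases) (use rp assms(3-8) W_R in auto)
  next
    case (va g)
    show ?thesis using assms(1)
      by (cases rule: blocks.cases) (use va assms(3-8) W_R in auto)
  next
    case (abc g s)
    show ?thesis using assms(1)
      by (cases rule: blocks.cases) (use abc assms(3-8) W_R in auto)
  qed
qed

lemma faces_C:
  assumes "B \<in> faces" shows "B \<in> C"
  unfolding C_def using assms faces_I by blast

lemma C_Inter:
  assumes A: "A \<subseteq> C" "A \<noteq> {}" shows "\<Inter>A \<in> C"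
proof -
  have "\<Inter>A \<subseteq> I" using A unfolding C_def by blast
  moreover have "x \<in> S" if "x \<in> I \<inter> \<Inter>{B \<in> faces. \<Inter>A \<subseteq> B}" "S \<in> A" for x S
  proof -
    have "I \<inter> \<Inter>{B \<in> faces. S \<subseteq> B} \<subseteq> S" using A(1) that(2) unfolding C_def by blast
    moreover have "x \<in> I \<inter> \<Inter>{B \<in> faces. S \<subseteq> B}" using that by blast
    ultimately show ?thesis by blast
  qed
  ultimately show ?thesis unfolding C_def by blast
qed

lemma C_face:
  assumes "S \<in> C" "S \<noteq> I" obtains B where "B \<in> faces" "S \<subseteq> B"
  using assms unfolding C_def by blast

text \<open>Only the blocks of kind \<open>pq\<close> can contain two points \<open>Pt p\<close>,
  and these are comparable; every other face contains at most one.\<close>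

lemma face_poset:
  assumes "B \<in> faces" "D \<subseteq> B \<inter> Pt ` P0" "D \<noteq> {}"
  shows "\<exists>d\<in>D. \<forall>d'\<in>D. ord d' d"
proof -
  have r: "ord (Pt p) (Pt p)" if "p \<in> P0" for p using that by (auto simp: ord_def P0_def)
  have "\<exists>p\<in>P0. \<exists>q\<in>P0. p \<sqsubseteq>\<^bsub>P\<^esub> q \<and> D \<subseteq> {Pt p, Pt q}"
  proof (cases "B \<in> blocks")
    case True
    then show ?thesis
    proof (cases rule: blocks.cases)
      case (pq p q) then show ?thesis using assms(2) by blast
    next
      case (rp p)
      then have "D \<subseteq> {Pt p, Pt p}" "p \<sqsubseteq>\<^bsub>P\<^esub> p" using assms(2) by (auto simp: P0_def)
      then show ?thesis using rp by blast
    next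
      case (W s)
      then have "B \<inter> Pt ` P0 = {}" by (auto simp: W_def)
      then have "D \<subseteq> {}" using assms(2) by simp
      then show ?thesis using assms(3) by blast
    next
      case (va g)
      then have "D \<subseteq> {}" using assms(2) by auto
      then show ?thesis using assms(3) by blast
    next
      case (abc g s)
      then have "D \<subseteq> {}" using assms(2) by auto
      then show ?thesis using assms(3) by blast
    qed
  next
    case False
    then obtain i where i: "B = {i}" using assms by (auto simp: faces_def)
    then obtain p where p: "p \<in> P0" "D \<subseteq> {Pt p, Pt p}" using assms(2,3) by blast
    then have "p \<sqsubseteq>\<^bsub>P\<^esub> p" by (simp add: P0_def)
    then show ?thesis using p by blast
  qed
  then obtain p q where p: "p \<in> P0" "q \<in> P0" "p \<sqsubseteq>\<^bsub>P\<^esub> q" "D \<subseteq> {Pt p, Pt q}" by blast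
  have pq: "ord (Pt p) (Pt q)" using p(3) by (simp add: ord_def)
  show ?thesis
  proof (cases "Pt q \<in> D")
    case True then show ?thesis using p pq r by blast
  next
    case False then show ?thesis using p r assms(3) by blast
  qed
qed

text \<open>\<open>Zt\<close> lies in no block, hence only in its own singleton face. The pair
  \<open>Nu\<close>, \<open>Ma \<one>\<close> serves as \<open>u\<close>, \<open>v\<close>: every
  block through \<open>Nu\<close> stays inside \<open>R\<close>, so no face contains both.\<close>

sublocale coloured_points I "Pt ` P0" bt ord C Zt Nu "Ma \<one>" e
proof
  show "Pt ` P0 \<subseteq> I" by auto
  show "inj_on bt (Pt ` P0)" by (auto simp: inj_on_def)
  show "bt q \<notin> I" if "q \<in> Pt ` P0" for q using that by auto
  show "ord q q" if "q \<in> Pt ` P0" for q using that by (auto simp: ord_def P0_def)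
  show "ord p r" if "p \<in> Pt ` P0" "q \<in> Pt ` P0" "r \<in> Pt ` P0" "ord p q" "ord q r" for p q r
    using that by (auto simp: ord_def P0_def intro: P.le_trans)
  show "p = q" if "p \<in> Pt ` P0" "q \<in> Pt ` P0" "ord p q" "ord q p" for p q
    using that by (auto simp: ord_def P0_def intro: P.le_antisym)
  show "S \<subseteq> I" if "S \<in> C" for S using that by (simp add: C_def)
  show "I \<in> C" by (simp add: C_def)
  show "\<Inter>A \<in> C" if "A \<subseteq> C" "A \<noteq> {}" for A using C_Inter that .
  show "{} \<in> C" by (rule faces_C) (simp add: faces_def)
  show "{i} \<in> C" if "i \<in> I" for i by (rule faces_C) (simp add: faces_def that)
  show "\<exists>S\<in>C. S \<noteq> I \<and> p \<in> S \<and> q \<in> S" if pq: "p \<in> Pt ` P0" "q \<in> Pt ` P0" "ord p q" for p q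
  proof -
    have "{p, q} \<in> blocks" using pq by (auto simp: ord_def intro: blocks.pq)
    then have "{p, q} \<in> C" "Zt \<notin> {p, q}" using Zt_block by (auto intro: faces_C simp: faces_def)
    moreover from this have "{p, q} \<noteq> I" by (metis I_simps(9))
    ultimately show ?thesis by (intro bexI[of _ "{p, q}"]) simp_all
  qed
  show "\<exists>d\<in>D. \<forall>d'\<in>D. ord d' d"
    if S: "S \<in> C" "S \<noteq> I" and D: "D \<subseteq> S \<inter> Pt ` P0" "D \<noteq> {}" for S D
  proof -
    obtain B where "B \<in> faces" "S \<subseteq> B" using C_face[OF S] .
    then show ?thesis using face_poset[of B D] D by blast
  qed
  show "S = {Zt} \<or> S = I" if "S \<in> C" "Zt \<in> S" for S
  proof (cases "S = I")
    case False
    then obtain B where B: "B \<in> faces" "S \<subseteq> B" using C_face[OF \<open>S \<in> C\<close>] by blast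
    have "B = {Zt}" using B that(2) Zt_block[of B] by (auto simp: faces_def)
    then show ?thesis using B that(2) by blast
  qed simp
  show "S = I" if "S \<in> C" "Nu \<in> S" "Ma \<one> \<in> S" for S
  proof (rule ccontr)
    assume "S \<noteq> I"
    then obtain B where B: "B \<in> faces" "S \<subseteq> B" using C_face[OF \<open>S \<in> C\<close>] by blast
    then have n: "Nu \<in> B" "Ma \<one> \<in> B" using that by auto
    then have "B \<in> blocks" using B(1) by (auto simp: faces_def)
    then show False by (cases rule: blocks.cases) (use n in \<open>auto simp: W_def\<close>)
  qed
qed (use inj_code in auto)

section \<open>Closures of pairs of points\<close>

text \<open>The hull of two distinct points in terms of blocks alone, as the other faces are too
  small to contain both. It is \<open>I\<close> when no block contains both.\<close>

definition cl :: "('p, 'g) pt \<Rightarrow> ('p, 'g) pt \<Rightarrow> ('p, 'g) pt set" where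
  "cl i j = I \<inter> \<Inter>{B \<in> blocks. i \<in> B \<and> j \<in> B}"

lemma hull_pair:
  assumes "i \<in> I" "j \<in> I" "i \<noteq> j" shows "hull {i, j} = cl i j"
proof
  have "cl i j \<in> C"
  proof -
    have "x \<in> cl i j" if "x \<in> I \<inter> \<Inter>{B \<in> faces. cl i j \<subseteq> B}" for x
    proof -
      have "x \<in> B" if B: "B \<in> blocks" "i \<in> B" "j \<in> B" for B
      proof -
        have "cl i j \<subseteq> B" using B by (auto simp: cl_def)
        then show ?thesis using \<open>x \<in> _\<close> B by (auto simp: faces_def)
      qed
      then show ?thesis using that by (simp add: cl_def)
    qed
    moreover have "cl i j \<subseteq> I" by (simp add: cl_def)
    ultimately show ?thesis unfolding C_def by blast
  qed
  moreover have "{i, j} \<subseteq> cl i j" using assms by (auto simp: cl_def)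
  ultimately show "hull {i, j} \<subseteq> cl i j" unfolding hull_def by blast
  show "cl i j \<subseteq> hull {i, j}"
    unfolding hull_def
  proof (rule Inter_greatest)
    fix S assume "S \<in> {S \<in> C. {i, j} \<subseteq> S}"
    then have S: "S \<in> C" "i \<in> S" "j \<in> S" by auto
    have "{B \<in> faces. S \<subseteq> B} \<subseteq> {B \<in> blocks. i \<in> B \<and> j \<in> B}"
      using S assms(3) by (auto simp: faces_def)
    then have "cl i j \<subseteq> I \<inter> \<Inter>{B \<in> faces. S \<subseteq> B}" unfolding cl_def by blast
    then show "cl i j \<subseteq> S" using S(1) unfolding C_def by blast
  qed
qed

lemma cl_block:
  assumes "B \<in> blocks" "\<not> B \<subseteq> R" "i \<in> B" "j \<in> B" "i \<noteq> j"
  shows "cl i j = B"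
proof -
  have "{B' \<in> blocks. i \<in> B' \<and> j \<in> B'} = {B}"
    using blocks_unique[OF assms(1) _ assms(2-4) _ _ assms(5)] assms by blast
  then show ?thesis using blocks_I[OF assms(1)] unfolding cl_def by auto
qed

text \<open>A block through \<open>s\<close> and \<open>t\<close> must lie inside \<open>R\<close>,
  so it is some \<open>W r\<close> with \<open>r\<close> equal to or above \<open>t\<close>, and
  \<open>W t\<close> is the smallest of these. Closures of pairs thus recover the well-order on
  \<open>R\<close>.\<close>

lemma cl_W:
  assumes "s \<in> R" "t \<in> R" "lt s t" shows "cl s t = W t"
proof
  have ne: "s \<noteq> t" using assms(3) lt_irrefl by blast
  have st: "s \<in> W t" "t \<in> W t" using assms by (auto simp: W_def)
  show "cl s t \<subseteq> W t" using blocks.W[OF assms(2)] st by (auto simp: cl_def)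
  have "W t \<subseteq> B" if B: "B \<in> blocks" "s \<in> B" "t \<in> B" for B
  proof (cases "B \<subseteq> R")
    case True
    then obtain r where r: "r \<in> R" "B = W r" using blocks_R[OF B(1)] by blast
    then have "t = r \<or> lt t r" using B(3) by (simp add: W_def)
    then show ?thesis using r(2) lt_trans unfolding W_def by blast
  next
    case False
    then show ?thesis
      using blocks_unique[OF B(1) blocks.W[OF assms(2)] False B(2,3) st ne] by simp
  qed
  moreover have "W t \<subseteq> I" using W_R R_I by blast
  ultimately show "W t \<subseteq> cl s t" unfolding cl_def by blast
qed

lemma cl_obtain:
  assumes "cl i j \<noteq> I" obtains B where "B \<in> blocks" "i \<in> B" "j \<in> B"
  using assms unfolding cl_def by blast

lemma blocks_proper: "B \<in> blocks \<Longrightarrow> B \<noteq> I"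
  using Zt_block I_simps(9) by metis

definition act :: "'g \<Rightarrow> ('p, 'g) pt \<Rightarrow> ('p, 'g) pt" where
  "act a x = (case x of Ma g \<Rightarrow> Ma (a \<otimes> g) | Mb g \<Rightarrow> Mb (a \<otimes> g) | _ \<Rightarrow> x)"

lemma act_simps [simp]: "act a (Ma g) = Ma (a \<otimes> g)" "act a (Mb g) = Mb (a \<otimes> g)"
  "act a (Bt p) = Bt p" "act a (Pt p) = Pt p" "act a (Rk p) = Rk p" "act a (Col g) = Col g"
  "act a Nu = Nu" "act a Nv = Nv" "act a Zt = Zt"
  by (simp_all add: act_def)

lemma act_R: "x \<in> R \<Longrightarrow> act a x = x"
  by (auto simp: R_def)

lemma cl_commute: "cl i j = cl j i"
  by (simp add: cl_def conj_commute)

lemma Nu_W: "s \<in> R \<Longrightarrow> Nu \<in> W s"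
  using Nu_least[of s] by (auto simp: W_def)

lemma Nv_W: "s \<in> R \<Longrightarrow> s \<noteq> Nu \<Longrightarrow> Nv \<in> W s"
  using Nv_least[of s] by (auto simp: W_def)

lemma W_self: "s \<in> R \<Longrightarrow> s \<in> W s"
  by (simp add: W_def)

lemma lt_asym: "lt x y \<Longrightarrow> \<not> lt y x"
  using lt_trans lt_irrefl by blast

lemma W_Nu: "W Nu = {Nu}"
proof -
  have "\<not> lt t Nu" for t using Nu_least[of t] lt_asym lt_irrefl by blast
  then show ?thesis by (auto simp: W_def)
qed

lemma W_Nv: "W Nv = {Nu, Nv}"
proof -
  have "t \<in> W Nv \<longleftrightarrow> t = Nu \<or> t = Nv" for t
    using Nu_W[of Nv] W_self[of Nv] Nv_least[of t] lt_asym[of Nv t] by (auto simp: W_def)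
  then show ?thesis by blast
qed

lemma cl_R:
  assumes "s \<in> R" "t \<in> R" "s \<noteq> t" obtains m where "m \<in> R" "m = s \<or> m = t" "cl s t = W m"
proof (cases "lt s t")
  case True then show ?thesis using cl_W[OF assms(1,2)] assms(2) by (intro that[of t]) auto
next
  case False
  then have "lt t s" using lt_total[OF assms(3)] by simp
  then show ?thesis using cl_W[OF assms(2,1)] assms(1) cl_commute[of s t] by (intro that[of s]) auto
qed

lemma cl_Nv_Ma: "g \<in> carrier G \<Longrightarrow> cl Nv (Ma g) = {Nv, Ma g}"
  by (rule cl_block[OF blocks.va]) auto

lemma cl_Ma_Col: "g \<in> carrier G \<Longrightarrow> s \<in> carrier G \<Longrightarrow> cl (Ma g) (Col s) = {Ma g, Mb (g \<otimes> s), Col s}"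
  by (rule cl_block[OF blocks.abc]) auto

lemma cl_Rk_Pt: "p \<in> P0 \<Longrightarrow> cl (Rk p) (Pt p) = {Rk p, Pt p}"
  by (rule cl_block[OF blocks.rp]) auto

lemma block_Nu: "B \<in> blocks \<Longrightarrow> Nu \<in> B \<Longrightarrow> B \<subseteq> R"
  by (erule blocks.cases) (auto simp: W_def)

lemma block_Nv: "B \<in> blocks \<Longrightarrow> Nv \<in> B \<Longrightarrow> x \<in> B \<Longrightarrow> x \<notin> R \<Longrightarrow> \<exists>g\<in>carrier G. x = Ma g"
  by (erule blocks.cases) (auto simp: W_def)

lemma block_Rk: "B \<in> blocks \<Longrightarrow> Rk p \<in> B \<Longrightarrow> x \<in> B \<Longrightarrow> x \<notin> R \<Longrightarrow> x = Pt p"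
  by (erule blocks.cases) (auto simp: W_def)

text \<open>A closure \<open>cl i j\<close> that contains the closure of another pair properly is an initial segment \<open>W s\<close>.
  Hence \<open>\<pi>\<close> maps \<open>R\<close> into \<open>R\<close>, and it fixes \<open>R\<close> pointwise by well-founded induction. Then \<open>\<pi>\<close> respects
  the coloured edges \<open>cl (Ma g) (Col s)\<close>, so it is a left translation.\<close>

lemma rigid:
  assumes bij: "bij_betw \<pi> I I"
    and hull: "\<And>i j k. i \<in> I \<Longrightarrow> j \<in> I \<Longrightarrow> k \<in> I \<Longrightarrow> \<pi> k \<in> hull {\<pi> i, \<pi> j} \<longleftrightarrow> k \<in> hull {i, j}"
  shows "\<exists>a\<in>carrier G. \<forall>i\<in>I. \<pi> i = act a i"
proof -
  have pI: "\<pi> i \<in> I" if "i \<in> I" for i using bij that by (rule bij_betw_apply)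
  have inj: "inj_on \<pi> I" and surj: "\<pi> ` I = I" using bij by (simp_all add: bij_betw_def)
  have eq: "\<pi> i = \<pi> j \<longleftrightarrow> i = j" if "i \<in> I" "j \<in> I" for i j
    using inj_on_eq_iff[OF inj that] .
  have cl: "\<pi> k \<in> cl (\<pi> i) (\<pi> j) \<longleftrightarrow> k \<in> cl i j" if "i \<in> I" "j \<in> I" "i \<noteq> j" "k \<in> I" for i j k
    using hull[OF that(1,2,4)] hull_pair[OF that(1-3)] hull_pair[OF pI pI, of i j] eq that by simp
  have clI: "cl i j \<subseteq> I" for i j by (simp add: cl_def)
  have img: "\<pi> ` cl i j = cl (\<pi> i) (\<pi> j)" if "i \<in> I" "j \<in> I" "i \<noteq> j" for i j
  proof
    show "\<pi> ` cl i j \<subseteq> cl (\<pi> i) (\<pi> j)" using cl[OF that] clI by blast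
    show "cl (\<pi> i) (\<pi> j) \<subseteq> \<pi> ` cl i j"
    proof
      fix x assume x: "x \<in> cl (\<pi> i) (\<pi> j)"
      then have "x \<in> \<pi> ` I" using clI surj by blast
      then obtain k where "k \<in> I" "x = \<pi> k" by blast
      then show "x \<in> \<pi> ` cl i j" using cl[OF that, of k] x by simp
    qed
  qed
  have clne: "cl (\<pi> i) (\<pi> j) \<noteq> I" if "i \<in> I" "j \<in> I" "i \<noteq> j" "cl i j \<noteq> I" for i j
    using img[OF that(1-3)] surj inj_on_image_eq_iff[OF inj clI[of i j] subset_refl] that(4) by simp
  have RI: "i \<in> I" if "i \<in> R" for i using that R_I by blast
  have clN: "cl Nu Nv = {Nu, Nv}"
    using cl_W[OF _ _ Nu_least, of Nv] W_Nv by simp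
  have piR: "\<pi> i \<in> R" if i: "i \<in> R" for i
  proof -
    \<comment> \<open>The partner \<open>c\<close> is chosen so that the larger of \<open>i\<close>
      and \<open>c\<close> is neither \<open>Nu\<close> nor \<open>Nv\<close>; then
      \<open>W m\<close> properly contains \<open>{Nu, Nv}\<close>.\<close>
    define c where "c = (if i = Nu \<or> i = Nv then Col \<one> else Nu :: ('p, 'g) pt)"
    have c: "c \<in> R" "i \<noteq> c" by (auto simp: c_def)
    obtain m where m: "m \<in> R" "m = i \<or> m = c" "cl i c = W m" using cl_R[OF i c] .
    have "i \<in> W m" "c \<in> W m"
      using m(3) i c RI by (auto simp: cl_def)
    then have mN: "m \<noteq> Nu" "m \<noteq> Nv" using c(2) W_Nu W_Nv by (auto simp: c_def split: if_splits)
    have "cl (\<pi> i) (\<pi> c) \<noteq> I"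
      by (rule clne) (use i c RI m blocks_proper[OF blocks.W[OF m(1)]] in auto)
    then obtain B where B: "B \<in> blocks" "\<pi> i \<in> B" "\<pi> c \<in> B" by (rule cl_obtain)
    \<comment> \<open>In a block outside \<open>R\<close> any two points generate the whole block.
      The preimage \<open>W m\<close> does not behave so, since its points \<open>Nu\<close> and
      \<open>Nv\<close> generate only \<open>{Nu, Nv}\<close>.\<close>
    have "B \<subseteq> R"
    proof (rule ccontr)
      assume nR: "\<not> B \<subseteq> R"
      have "cl (\<pi> i) (\<pi> c) = B"
        by (rule cl_block[OF B(1) nR B(2,3)]) (use eq i c RI in simp)
      then have BW: "\<pi> ` W m = B" using img[of i c] i c RI m(3) by simp
      then have "\<pi> Nu \<in> B" "\<pi> Nv \<in> B" using Nu_W[OF m(1)] Nv_W[OF m(1) mN(1)] by blast+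
      then have "cl (\<pi> Nu) (\<pi> Nv) = B"
        by (intro cl_block[OF B(1) nR]) (use eq in simp_all)
      then have "\<pi> ` {Nu, Nv} = \<pi> ` W m" using img[of Nu Nv] clN BW by simp
      then have "{Nu, Nv} = W m"
        using inj_on_image_eq_iff[OF inj, of "{Nu, Nv}" "W m"] W_R[of m] R_I by auto
      then show False using W_self[OF m(1)] mN by blast
    qed
    then show ?thesis using B(2) by blast
  qed
  have cN: "cl (\<pi> Nu) (\<pi> Nv) = {\<pi> Nu, \<pi> Nv}" using img[of Nu Nv] clN by simp
  have NuNv: "\<pi> Nu \<noteq> \<pi> Nv" using eq[of Nu Nv] by simp
  \<comment> \<open>The image of the closed pair \<open>{Nu, Nv}\<close> is an initial segment with
    two points, so it is \<open>{Nu, Nv}\<close> again, possibly with the two points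
    swapped.\<close>
  obtain m where m: "m \<in> R" "cl (\<pi> Nu) (\<pi> Nv) = W m"
    by (rule cl_R[OF piR[of Nu] piR[of Nv] NuNv]) simp_all
  have Wm: "W m = {\<pi> Nu, \<pi> Nv}" using m(2) cN by simp
  have "m \<noteq> Nu"
  proof
    assume "m = Nu"
    then have "\<pi> Nu \<in> {Nu}" "\<pi> Nv \<in> {Nu}" using Wm W_Nu by blast+
    then show False using NuNv by simp
  qed
  then have "{Nu, Nv} \<subseteq> {\<pi> Nu, \<pi> Nv}" using Nu_W[OF m(1)] Nv_W[OF m(1)] Wm by simp
  then have cases: "\<pi> Nu = Nu \<and> \<pi> Nv = Nv \<or> \<pi> Nu = Nv \<and> \<pi> Nv = Nu" by auto
  have N: "\<pi> Nu = Nu" "\<pi> Nv = Nv"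
  proof -
    \<comment> \<open>The blocks \<open>va\<close> rule out a swap: \<open>Nv\<close> and
      \<open>Ma \<one>\<close> form a closed pair, whereas the closure of \<open>Nu\<close> with any
      further point of \<open>R\<close> also contains \<open>Nv\<close>, and with a point outside
      \<open>R\<close> it is all of \<open>I\<close>.\<close>
    have False if sw: "\<pi> Nu = Nv" "\<pi> Nv = Nu"
    proof -
      define x where "x = \<pi> (Ma \<one>)"
      have clx: "cl Nu x = {Nu, x}" using img[of Nv "Ma \<one>"] cl_Nv_Ma[of \<one>] sw by (simp add: x_def)
      have xN: "x \<noteq> Nu" "x \<noteq> Nv" using eq[of "Ma \<one>" Nv] eq[of "Ma \<one>" Nu] sw by (simp_all add: x_def)
      have "cl (\<pi> Nv) x \<noteq> I"
        unfolding x_def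
        by (rule clne) (use cl_Nv_Ma[of \<one>] blocks_proper[OF blocks.va[of \<one>]] in simp_all)
      then have "cl Nu x \<noteq> I" using sw by simp
      then obtain B where B: "B \<in> blocks" "Nu \<in> B" "x \<in> B" by (rule cl_obtain)
      then have xR: "x \<in> R" using block_Nu by blast
      have "cl Nu x = W x" by (rule cl_W) (use xR xN Nu_least in auto)
      then show False using clx Nv_W[OF xR xN(1)] xN by auto
    qed
    then show "\<pi> Nu = Nu" "\<pi> Nv = Nv" using cases by blast+
  qed
  have fixR: "s \<in> R \<longrightarrow> \<pi> s = s" for s
  proof (induction s rule: wfp_induct_rule[OF wf_lt])
    case (1 s)
    show ?case
    proof
      assume s: "s \<in> R"
      show "\<pi> s = s"
      proof (cases "s = Nu")
        case False
        have ps: "\<pi> s \<in> R" "\<pi> s \<noteq> Nu" using piR[OF s] eq[of s Nu] N False s RI by auto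
        \<comment> \<open>\<open>Nu\<close> is fixed and least, so an initial segment is the closure
          of its largest point with \<open>Nu\<close>, and \<open>\<pi>\<close> carries initial
          segments to initial segments.\<close>
        have WW: "\<pi> ` W s = W (\<pi> s)"
          using img[of Nu s] cl_W[OF _ s Nu_least] cl_W[OF _ ps(1) Nu_least] False ps N s RI by simp
        have below: "\<pi> t = t" if "t \<in> W s" "t \<noteq> s" for t using 1 that by (auto simp: W_def)
        have down: False if "lt (\<pi> s) s"
        proof -
          have "\<pi> (\<pi> s) = \<pi> s" using 1 that ps by blast
          then have "\<pi> s = s" using eq[of "\<pi> s" s] ps s RI by simp
          then show False using that lt_irrefl by simp
        qed
        show ?thesis
        \<comment> \<open>If \<open>\<pi> s\<close> were above \<open>s\<close>, then
          \<open>s\<close> would be the image of some \<open>t\<close> in \<open>W s\<close> other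
          than \<open>s\<close>, but such \<open>t\<close> are fixed by induction.\<close>
        proof (rule ccontr)
          assume ne: "\<pi> s \<noteq> s"
          then have "lt s (\<pi> s)" using lt_total[of "\<pi> s" s] down by blast
          then have "s \<in> W (\<pi> s)" using s by (simp add: W_def)
          then have "s \<in> \<pi> ` W s" using WW by simp
          then obtain t where t: "t \<in> W s" "\<pi> t = s" by (metis imageE)
          then have "t \<noteq> s" using ne by metis
          then show False using below[OF t(1)] t(2) by metis
        qed
      qed (use N in simp)
    qed
  qed
  have out: "\<pi> x \<notin> R" if "x \<in> I" "x \<notin> R" for x
  proof
    assume r: "\<pi> x \<in> R"
    then have "\<pi> (\<pi> x) = \<pi> x" using fixR by blast
    then have "\<pi> x = x" using eq[of "\<pi> x" x] r that RI by simp
    then show False using r that by simp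
  qed
  \<comment> \<open>\<open>\<pi> (Ma g)\<close> lies outside \<open>R\<close> and shares a block
    with the fixed point \<open>Nv\<close>; the only such points are those of the first
    copy.\<close>
  have "\<exists>h\<in>carrier G. \<pi> (Ma g) = Ma h" if g: "g \<in> carrier G" for g
  proof -
    have "cl (\<pi> Nv) (\<pi> (Ma g)) \<noteq> I"
      by (rule clne) (use g cl_Nv_Ma[OF g] blocks_proper[OF blocks.va[OF g]] in simp_all)
    then obtain B where "B \<in> blocks" "\<pi> Nv \<in> B" "\<pi> (Ma g) \<in> B" by (rule cl_obtain)
    then show ?thesis using block_Nv[of B "\<pi> (Ma g)"] N out[of "Ma g"] g by simp
  qed
  then obtain \<sigma> where \<sigma>: "\<And>g. g \<in> carrier G \<Longrightarrow> \<sigma> g \<in> carrier G" "\<And>g. g \<in> carrier G \<Longrightarrow> \<pi> (Ma g) = Ma (\<sigma> g)"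
    by metis
  \<comment> \<open>The closure of \<open>Ma g\<close> and the fixed colour \<open>Col s\<close> has
    a single third point, the end of the edge, so \<open>\<pi>\<close> must carry ends to
    ends.\<close>
  have Mb: "\<pi> (Mb (g \<otimes> s)) = Mb (\<sigma> g \<otimes> s)" if "g \<in> carrier G" "s \<in> carrier G" for g s
  proof -
    have C: "\<pi> (Col s) = Col s" using fixR that by simp
    have "\<pi> (Mb (g \<otimes> s)) \<in> cl (\<pi> (Ma g)) (\<pi> (Col s))"
      using cl[of "Ma g" "Col s" "Mb (g \<otimes> s)"] cl_Ma_Col[OF that] that by simp
    then have "\<pi> (Mb (g \<otimes> s)) \<in> {Ma (\<sigma> g), Mb (\<sigma> g \<otimes> s), Col s}"
      using cl_Ma_Col[OF \<sigma>(1) that(2)] \<sigma>(2) C that by simp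
    moreover have "\<pi> (Mb (g \<otimes> s)) \<noteq> Ma (\<sigma> g)" "\<pi> (Mb (g \<otimes> s)) \<noteq> Col s"
      using eq[of "Mb (g \<otimes> s)" "Ma g"] eq[of "Mb (g \<otimes> s)" "Col s"] \<sigma>(2) C that by simp_all
    ultimately show ?thesis by blast
  qed
  \<comment> \<open>The edges starting at \<open>\<one>\<close> reach every \<open>Mb g\<close> and
    show that \<open>\<pi>\<close> multiplies the second copy by \<open>a\<close> on the left. The
    edges of colour \<open>\<one>\<close> transfer this to the first copy.\<close>
  define a where "a = \<sigma> \<one>"
  have a: "a \<in> carrier G" using \<sigma>(1) by (simp add: a_def)
  have b: "\<pi> (Mb g) = Mb (a \<otimes> g)" if "g \<in> carrier G" for g
    using Mb[of \<one> g] that by (simp add: a_def)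
  have m: "\<pi> (Ma g) = Ma (a \<otimes> g)" if "g \<in> carrier G" for g
    using Mb[of g \<one>] b[OF that] \<sigma> that by simp
  have p: "\<pi> (Pt q) = Pt q" if q: "q \<in> P0" for q
  proof -
    have "cl (\<pi> (Rk q)) (\<pi> (Pt q)) \<noteq> I"
      by (rule clne) (use q cl_Rk_Pt[OF q] blocks_proper[OF blocks.rp[OF q]] in simp_all)
    then obtain B where "B \<in> blocks" "\<pi> (Rk q) \<in> B" "\<pi> (Pt q) \<in> B" by (rule cl_obtain)
    then show ?thesis using block_Rk[of B q "\<pi> (Pt q)"] fixR q out[of "Pt q"] by simp
  qed
  \<comment> \<open>All other points are already mapped among themselves, so surjectivity leaves
    \<open>Zt\<close> as the only preimage of \<open>Zt\<close>.\<close>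
  have z: "\<pi> Zt = Zt"
  proof -
    obtain x where x: "x \<in> I" "\<pi> x = Zt" using surj I_simps(9) by (metis imageE)
    show ?thesis
    proof (cases x)
      case Zt then show ?thesis using x by simp
    qed (use x fixR b m p in auto)
  qed
  have "\<pi> i = act a i" if "i \<in> I" for i
    using that fixR b m p z by (cases i) simp_all
  then show ?thesis using a by blast
qed

section \<open>Left translations as lattice automorphisms\<close>

text \<open>Initial segments are fixed pointwise. For the coloured edges, associativity is what
  makes left translation compatible with the right multiplication by the colour.\<close>

lemma act_blocks:
  assumes "a \<in> carrier G" "B \<in> blocks" shows "act a ` B \<in> blocks"
  using assms(2)
proof (cases rule: blocks.cases)
  case (W s)
  have "act a ` W s = (\<lambda>x. x) ` W s"
    by (rule image_cong) (use W_R[of s] act_R in blast)+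
  then show ?thesis using W blocks.W by simp
next
  case (abc g s)
  then show ?thesis using assms(1) blocks.abc[of "a \<otimes> g" s] by (simp add: m_assoc)
qed (use assms(1) blocks.intros in auto)

lemma act_I: "a \<in> carrier G \<Longrightarrow> x \<in> I \<Longrightarrow> act a x \<in> I"
  by (cases x) auto

lemma act_faces: "a \<in> carrier G \<Longrightarrow> B \<in> faces \<Longrightarrow> act a ` B \<in> faces"
  using act_blocks act_I unfolding faces_def by auto

lemma act_mult: "a \<in> carrier G \<Longrightarrow> c \<in> carrier G \<Longrightarrow> x \<in> E \<Longrightarrow> act (a \<otimes> c) x = act a (act c x)"
  unfolding E_def by (cases x) (auto simp: m_assoc)

lemma act_one: "x \<in> E \<Longrightarrow> act \<one> x = x"
  unfolding E_def by (cases x) auto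

lemma act_inv:
  assumes "a \<in> carrier G" "x \<in> E"
  shows "act (inv a) (act a x) = x" "act a (act (inv a) x) = x"
  using act_mult[of "inv a" a x] act_mult[of a "inv a" x] act_one[of x] assms by simp_all

lemma act_bij: "a \<in> carrier G \<Longrightarrow> bij_betw (act a) I I"
  by (rule bij_betwI[where g = "act (inv a)"]) (use act_I act_inv I_E in auto)

lemma act_C:
  assumes a: "a \<in> carrier G" and S: "S \<in> C" shows "act a ` S \<in> C"
proof -
  have SI: "S \<subseteq> I" using S by (simp add: C_def)
  have "x \<in> act a ` S" if x: "x \<in> I" "\<And>B. B \<in> faces \<Longrightarrow> act a ` S \<subseteq> B \<Longrightarrow> x \<in> B" for x
  proof -
    have "act (inv a) x \<in> B" if B: "B \<in> faces" "S \<subseteq> B" for B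
    proof -
      have "x \<in> act a ` B" by (rule x(2)[OF act_faces[OF a B(1)] image_mono[OF B(2)]])
      then obtain y where y: "y \<in> B" "x = act a y" by blast
      then show ?thesis using act_inv(1)[OF a, of y] faces_I[OF B(1)] I_E by auto
    qed
    then have "act (inv a) x \<in> S"
      using S act_I[OF inv_closed[OF a] x(1)] unfolding C_def by blast
    then have "act a (act (inv a) x) \<in> act a ` S" by (rule imageI)
    moreover have "act a (act (inv a) x) = x" by (rule act_inv(2)[OF a]) (use x(1) I_E in blast)
    ultimately show ?thesis by simp
  qed
  moreover have "act a ` S \<subseteq> I" using SI act_I[OF a] by blast
  ultimately show ?thesis unfolding C_def by blast
qed

lemma act_K: "a \<in> carrier G \<Longrightarrow> X \<in> K \<Longrightarrow> act a ` X \<in> K"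
  by (rule image_K[OF act_bij]) (auto intro: act_C)

lemma act_order_aut:
  assumes "a \<in> carrier G" shows "order_aut (image (act a))"
  by (rule image_order_aut[OF act_K[OF assms] act_K[OF inv_closed[OF assms]]])
    (simp_all add: act_inv[OF assms])

definition \<Phi> :: "'g \<Rightarrow> 'b set \<Rightarrow> 'b set" where
  "\<Phi> a = (\<lambda>x\<in>carrier lat. e ` act a ` (e -` x))"

lemma \<Phi>_apply: "X \<in> K \<Longrightarrow> \<Phi> a (e ` X) = e ` act a ` X"
  by (simp add: \<Phi>_def)

lemma \<Phi>_auts: "a \<in> carrier G \<Longrightarrow> \<Phi> a \<in> lattice_auts lat"
  unfolding \<Phi>_def by (rule lattice_autsI[OF act_order_aut])

lemma \<Phi>_mult:
  assumes "a \<in> carrier G" "c \<in> carrier G"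
  shows "\<Phi> (a \<otimes> c) = compose (carrier lat) (\<Phi> a) (\<Phi> c)"
proof
  fix x
  show "\<Phi> (a \<otimes> c) x = compose (carrier lat) (\<Phi> a) (\<Phi> c) x"
  proof (cases "x \<in> carrier lat")
    case True
    then obtain X where X: "X \<in> K" "x = e ` X" by auto
    have "act (a \<otimes> c) ` X = act a ` act c ` X"
      using act_mult[OF assms] KD(6)[OF X(1)] by (auto simp: image_image subset_iff intro!: image_cong)
    then show ?thesis
      using X True \<Phi>_apply[OF X(1)] \<Phi>_apply[OF act_K[OF assms(2) X(1)]] by (simp add: compose_def)
  next
    case False
    then show ?thesis by (simp add: \<Phi>_def compose_def)
  qed
qed

lemma \<Phi>_inj: "inj_on \<Phi> (carrier G)"
proof (rule inj_onI)
  fix a c assume ac: "a \<in> carrier G" "c \<in> carrier G" "\<Phi> a = \<Phi> c"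
  have "{Ma \<one>} \<in> K" by (rule single_K) simp
  then have "e ` act a ` {Ma \<one>} = e ` act c ` {Ma \<one>}" using \<Phi>_apply ac(3) by metis
  then have "act a ` {Ma \<one>} = act c ` {Ma \<one>}" by (simp only: image_e_eq)
  then show "a = c" using ac by simp
qed

text \<open>The point permutation of an automorphism is a translation by \<open>rigid\<close>.
  Translations fix every point that carries a marker, so \<open>order_aut_eq_image\<close>
  determines the automorphism on all closed sets.\<close>

lemma \<Phi>_surj:
  assumes f: "f \<in> lattice_auts lat" shows "f \<in> \<Phi> ` carrier G"
proof -
  obtain h where h: "order_aut h" "\<And>X. X \<in> K \<Longrightarrow> f (e ` X) = e ` h X"
    by (rule lattice_auts_order_aut[OF f], rule that) simp_all
  show ?thesis
  proof (rule order_aut_points[OF h(1)])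
    fix \<pi> assume \<pi>: "bij_betw \<pi> I I" "\<And>i. i \<in> I \<Longrightarrow> h {i} = {\<pi> i}"
      "\<And>X i. X \<in> K \<Longrightarrow> i \<in> I \<Longrightarrow> \<pi> i \<in> h X \<longleftrightarrow> i \<in> X"
      "\<And>i j k. i \<in> I \<Longrightarrow> j \<in> I \<Longrightarrow> k \<in> I \<Longrightarrow> \<pi> k \<in> hull {\<pi> i, \<pi> j} \<longleftrightarrow> k \<in> hull {i, j}"
    obtain a where a: "a \<in> carrier G" "\<And>i. i \<in> I \<Longrightarrow> \<pi> i = act a i"
      using rigid[OF \<pi>(1,4)] by blast
    have hX: "h X = act a ` X" if "X \<in> K" for X
      by (rule order_aut_eq_image[OF h(1) \<pi>(1-3) _ _ _ that]) (use a in auto)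
    have "f = \<Phi> a"
    proof
      fix x
      show "f x = \<Phi> a x"
      proof (cases "x \<in> carrier lat")
        case True
        then obtain X where X: "X \<in> K" "x = e ` X" by auto
        then show ?thesis using h(2)[OF X(1)] hX[OF X(1)] \<Phi>_apply[OF X(1)] by simp
      next
        case False
        have "f x = undefined"
          by (rule extensional_arb[OF _ False]) (use f in \<open>simp add: lattice_auts_def\<close>)
        then show ?thesis using False by (simp add: \<Phi>_def)
      qed
    qed
    then show "f \<in> \<Phi> ` carrier G" using a by blast
  qed
qed

lemma Aut_iso: "G \<cong> Aut lat"
proof (rule is_isoI, rule isoI)
  show "\<Phi> \<in> hom G (Aut lat)"
    by (rule homI) (simp_all add: Aut_def \<Phi>_auts \<Phi>_mult)
  show "bij_betw \<Phi> (carrier G) (carrier (Aut lat))"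
    using \<Phi>_inj \<Phi>_surj \<Phi>_auts by (auto simp: bij_betw_def Aut_def)
qed

section \<open>The isomorphism with the ordered set of principal congruences\<close>

definition pcon :: "'p \<Rightarrow> (('p, 'g) pt set \<times> ('p, 'g) pt set) set" where
  "pcon p = (if p = bo then Id_on K else if p = to then K \<times> K else theta (Pt p))"

lemma pcon_le:
  assumes x: "x \<in> carrier P" and y: "y \<in> carrier P"
  shows "x \<sqsubseteq>\<^bsub>P\<^esub> y \<longleftrightarrow> pcon x \<subseteq> pcon y"
proof -
  have bl: "bo \<sqsubseteq>\<^bsub>P\<^esub> w" "w \<sqsubseteq>\<^bsub>P\<^esub> to" if "w \<in> carrier P" for w
    using bo to that by (simp_all add: least_def greatest_def)
  have bc: "bo \<in> carrier P" "to \<in> carrier P" using bo to by (simp_all add: least_def greatest_def)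
  have th: "theta (Pt p) \<subseteq> theta (Pt q) \<longleftrightarrow> p \<sqsubseteq>\<^bsub>P\<^esub> q" if "p \<in> P0" "q \<in> P0" for p q
    using theta_mono[of "Pt p" "Pt q"] that by (simp add: ord_def)
  have P0: "w \<in> P0" if "w \<in> carrier P" "w \<noteq> bo" "w \<noteq> to" for w using that by (simp add: P0_def)
  have tb: "Id_on K \<subseteq> theta (Pt w)" "theta (Pt w) \<subseteq> K \<times> K" "\<not> theta (Pt w) \<subseteq> Id_on K"
    "\<not> K \<times> K \<subseteq> theta (Pt w)" if "w \<in> P0" for w
    using theta_bounds[of "Pt w"] that by simp_all
  have Id: "Id_on K \<subseteq> K \<times> K" by (rule Id_on_subset_Times)
  have xb: "x \<sqsubseteq>\<^bsub>P\<^esub> bo \<longleftrightarrow> x = bo" using bl[OF x] P.le_antisym x bc P.le_refl by blast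
  have ty: "to \<sqsubseteq>\<^bsub>P\<^esub> y \<longleftrightarrow> y = to" using bl[OF y] P.le_antisym y bc P.le_refl by blast
  consider "x = bo" | "x \<noteq> bo" "y = bo" | "x = to" "y \<noteq> bo" | "x \<noteq> bo" "x \<noteq> to" "y = to"
    | "x \<noteq> bo" "x \<noteq> to" "y \<noteq> bo" "y \<noteq> to" by blast
  then show ?thesis
  proof cases
    case 1
    have "Id_on K \<subseteq> pcon y" using tb(1)[OF P0[OF y]] Id by (simp add: pcon_def)
    then show ?thesis using 1 bl(1)[OF y] by (simp add: pcon_def)
  next
    case 2 then show ?thesis using xb tb(3)[OF P0[OF x]] Id_total by (simp add: pcon_def)
  next
    case 3 then show ?thesis using ty tb(4)[OF P0[OF y]] bo_to by (simp add: pcon_def)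
  next
    case 4 then show ?thesis using bl(2)[OF x] tb(2)[OF P0[OF x]] bo_to by (simp add: pcon_def)
  next
    case 5 then show ?thesis using th[OF P0[OF x] P0[OF y]] by (simp add: pcon_def)
  qed
qed

lemma Princ_iso: "order_iso_to_sets P (Princ lat)"
  unfolding order_iso_to_sets_def
proof (intro exI conjI ballI)
  show "x \<sqsubseteq>\<^bsub>P\<^esub> y \<longleftrightarrow> (lift \<circ> pcon) x \<subseteq> (lift \<circ> pcon) y" if "x \<in> carrier P" "y \<in> carrier P" for x y
    using pcon_le[OF that] by simp
  have bc: "bo \<in> carrier P" "to \<in> carrier P" using bo to by (simp_all add: least_def greatest_def)
  then have "carrier P = {bo, to} \<union> P0" by (auto simp: P0_def)
  moreover have "pcon ` P0 = theta ` Pt ` P0" by (auto simp: pcon_def P0_def image_image)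
  moreover have "pcon ` {bo, to} = {Id_on K, K \<times> K}" using bo_to by (simp add: pcon_def insert_commute)
  ultimately have "pcon ` carrier P = {Id_on K, K \<times> K} \<union> theta ` Pt ` P0" by (metis image_Un)
  then have "(lift \<circ> pcon) ` carrier P = Princ lat"
    unfolding Princ_lat image_comp[symmetric] by simp
  moreover have "inj_on (lift \<circ> pcon) (carrier P)"
  proof (rule inj_onI)
    fix x y assume xy: "x \<in> carrier P" "y \<in> carrier P" "(lift \<circ> pcon) x = (lift \<circ> pcon) y"
    then have "pcon x = pcon y" by simp
    then have "x \<sqsubseteq>\<^bsub>P\<^esub> y" "y \<sqsubseteq>\<^bsub>P\<^esub> x" using pcon_le[OF xy(1,2)] pcon_le[OF xy(2,1)] by simp_all
    then show "x = y" using xy by (intro P.le_antisym)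
  qed
  ultimately show "bij_betw (lift \<circ> pcon) (carrier P) (Princ lat)" by (simp add: bij_betw_def)
qed

end

section \<open>A well-order and a coding of the points\<close>

lemma wellorder_with_first_two:
  fixes x y :: 'a
  assumes "x \<noteq> y"
  obtains lt :: "'a \<Rightarrow> 'a \<Rightarrow> bool" where "wfP lt" "\<And>a b c. lt a b \<Longrightarrow> lt b c \<Longrightarrow> lt a c"
    "\<And>a b. a \<noteq> b \<Longrightarrow> lt a b \<or> lt b a" "\<And>a. a \<noteq> x \<Longrightarrow> lt x a" "\<And>a. a \<noteq> x \<Longrightarrow> a \<noteq> y \<Longrightarrow> lt y a"
proof -
  obtain r :: "'a rel" where r: "Well_order r" "Field r = UNIV"
    using well_ordering[where 'a = 'a] by auto
  have wf: "wf (r - Id)" and lin: "linear_order_on UNIV r"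
    using r by (simp_all add: well_order_on_def)
  have tr: "trans r" and an: "antisym r" and to: "total_on UNIV r"
    using lin by (simp_all add: linear_order_on_def partial_order_on_def preorder_on_def)
  have tr': "trans (r - Id)" by (rule trans_diff_Id[OF tr an])
  \<comment> \<open>An arbitrary well-order is refined lexicographically by this rank, which moves
    \<open>x\<close> and \<open>y\<close> to the front.\<close>
  define rk where "rk a = (if a = x then 0 else if a = y then 1 else 2 :: nat)" for a
  define lt where "lt a b \<longleftrightarrow> rk a < rk b \<or> rk a = rk b \<and> (a, b) \<in> r - Id" for a b
  show ?thesis
  proof (rule that[of lt])
    have "{(a, b). lt a b} \<subseteq> inv_image (less_than <*lex*> (r - Id)) (\<lambda>a. (rk a, a))"
      by (auto simp: lt_def)
    moreover have "wf (inv_image (less_than <*lex*> (r - Id)) (\<lambda>a. (rk a, a)))"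
      by (intro wf_inv_image wf_lex_prod wf_less_than wf)
    ultimately show "wfP lt" unfolding wfp_def by (rule wf_subset[rotated])
    show "lt a c" if "lt a b" "lt b c" for a b c
      using that transD[OF tr', of a b c] unfolding lt_def by linarith
    show "lt a b \<or> lt b a" if "a \<noteq> b" for a b
      using to that unfolding lt_def total_on_def by (cases "rk a" "rk b" rule: linorder_cases) auto
    show "lt x a" if "a \<noteq> x" for a using that by (simp add: lt_def rk_def)
    show "lt y a" if "a \<noteq> x" "a \<noteq> y" for a using that assms by (simp add: lt_def rk_def)
  qed
qed

text \<open>The summand \<open>nat\<close> makes the target type infinite even for finite
  \<open>'p\<close> and \<open>'g\<close>, so its square embeds into it. Each constructor becomes a
  pair of a tag and an argument; three tags and three kinds of argument cover the nine
  constructors.\<close>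

lemma inj_pt: "\<exists>e :: ('p, 'g) pt \<Rightarrow> 'p + 'g + nat. inj e"
proof -
  have inf: "infinite (UNIV :: ('p + 'g + nat) set)"
  proof
    assume "finite (UNIV :: ('p + 'g + nat) set)"
    then have "finite (range (\<lambda>n. Inr (Inr n) :: 'p + 'g + nat))" by (rule rev_finite_subset) simp
    then show False by (simp add: finite_image_iff inj_def)
  qed
  obtain f :: "('p + 'g + nat) \<times> ('p + 'g + nat) \<Rightarrow> 'p + 'g + nat" where f: "inj f"
    using iffD2[OF card_of_ordLeq ordIso_imp_ordLeq[OF card_of_Times_same_infinite[OF inf]]] by auto
  define k :: "('p, 'g) pt \<Rightarrow> ('p + 'g + nat) \<times> ('p + 'g + nat)" where
    "k x = (case x of Bt p \<Rightarrow> (Inr (Inr 0), Inl p) | Pt p \<Rightarrow> (Inr (Inr 1), Inl p)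
      | Rk p \<Rightarrow> (Inr (Inr 2), Inl p) | Col g \<Rightarrow> (Inr (Inr 0), Inr (Inl g))
      | Ma g \<Rightarrow> (Inr (Inr 1), Inr (Inl g)) | Mb g \<Rightarrow> (Inr (Inr 2), Inr (Inl g))
      | Nu \<Rightarrow> (Inr (Inr 0), Inr (Inr 0)) | Nv \<Rightarrow> (Inr (Inr 1), Inr (Inr 0))
      | Zt \<Rightarrow> (Inr (Inr 2), Inr (Inr 0)))" for x
  have "inj k"
  proof (rule injI)
    fix x y assume "k x = k y"
    then show "x = y" by (cases x; cases y) (simp_all add: k_def)
  qed
  then have "inj (f \<circ> k)" using f by (intro inj_compose)
  then show ?thesis by blast
qed

theorem theorem1:
  fixes P :: "'p gorder" and G :: "('g, 'm) monoid_scheme"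
  assumes "bounded_poset P"
    and "\<exists>x\<in>carrier P. \<exists>y\<in>carrier P. x \<noteq> y"
    and "group G"
  shows "\<exists>L :: ('p + 'g + nat) set gorder.
           bounded_lattice L \<and> order_iso_to_sets P (Princ L) \<and> G \<cong> Aut L"
proof -
  obtain bo to where P: "partial_order P" "least P bo (carrier P)" "greatest P to (carrier P)"
    using assms(1) by (auto simp: bounded_poset_def)
  interpret P: partial_order P by (rule P(1))
  have "bo \<noteq> to"
  proof
    assume eq: "bo = to"
    have "w = bo" if "w \<in> carrier P" for w
      using that P(2,3) eq by (intro P.le_antisym) (auto simp: least_def greatest_def)
    then show False using assms(2) by metis
  qed
  obtain e :: "('p, 'g) pt \<Rightarrow> 'p + 'g + nat" where "inj e" using inj_pt by blast
  obtain lt :: "('p, 'g) pt \<Rightarrow> ('p, 'g) pt \<Rightarrow> bool" where lt: "wfP lt" "\<And>a b c. lt a b \<Longrightarrow> lt b c \<Longrightarrow> lt a c"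
    "\<And>a b. a \<noteq> b \<Longrightarrow> lt a b \<or> lt b a" "\<And>a. a \<noteq> Nu \<Longrightarrow> lt Nu a" "\<And>a. a \<noteq> Nu \<Longrightarrow> a \<noteq> Nv \<Longrightarrow> lt Nv a"
    by (rule wellorder_with_first_two[of "Nu :: ('p, 'g) pt" Nv]) auto
  interpret L: poset_group P G bo to lt e
    by (rule poset_group.intro) (fact P assms(3) \<open>bo \<noteq> to\<close> lt \<open>inj e\<close>)+
  show ?thesis
    using L.bounded_lattice_lat L.Princ_iso L.Aut_iso by blast
qed

end
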